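(* Let $A\in 2^\omega$ and let $(\mathcal{U}_n)_{n\in\mathbb{N}}$ be a universal Martin-Löf test. The following are equivalent. (i) $A\in\mathrm{High}(\mathrm{CR},\mathrm{MLR})$, i.e., $\mathrm{CR}^A\subseteq\mathrm{MLR}$. (ii) Every bounded c.e. open set is covered by (i.e., contained in) an $A$-winning open set. (iii) The first level $\mathcal{U}_1$ of the universal Martin-Löf test is covered by an $A$-winning open set. (iv) There exists an $A$-computable martingale that succeeds on every $X\in 2^\omega$ that is not Martin-Löf random.
   Context: $2^\omega$ is Cantor space, $2^{<\omega}$ the set of finite binary strings, $\epsilon$ the empty string, $\mu$ the uniform measure. For $U\subseteq 2^{<\omega}$, $[U]$ is the set of infinite sequences having a prefix in $U$. A c.e. open set is a set $[U]$ with $U$ a c.e. prefix-free set of strings; it is bounded if its measure is smaller than $1$. A Martin-Löf test is a non-increasing sequence $(\mathcal{U}_n)_{n\in\mathbb{N}}$ of uniformly c.e. open sets with $\mu(\mathcal{U}_n)\leq 2^{-n}$ for all $n$; $X$ passes it if $X\notin\bigcap_n\mathcal{U}_n$; $\mathrm{MLR}$ is the set of (Martin-Löf random) sequences passing all Martin-Löf tests; a Martin-Löf test is universal if every $X$ passes it if and only if $X$ is Martin-Löf random. A martingale is a function $d:2^{<\omega}\to\mathbb{R}^{\geq 0}$ with $d(\sigma)=\frac{d(\sigma 0)+d(\sigma 1)}{2}$ for all $\sigma$; it is normed if $d(\epsilon)=1$; it succeeds on $X$ if $\limsup_n d(X\upharpoonright n)=+\infty$. $\mathrm{CR}^A$ is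 the set of sequences on which no $A$-computable (real-valued) martingale succeeds. A martingale is exactly $A$-computable if it is rational-valued and $A$-computable as a function into $\mathbb{Q}^{\geq 0}$. A string is minimal for a property if it satisfies the property and no proper prefix of it does. An $A$-winning open set is a set $[U]$ where $U=\{\sigma:\sigma\text{ minimal such that }d(\sigma)\geq q\}$ for some exactly $A$-computable normed martingale $d$ and rational $q>1$. *)

theory Defs
  imports "HOL-Probability.Probability" "HOL-Library.Sublist" "HOL-Library.Countable"
    "HOL-Library.Nat_Bijection"
begin

type_synonym cantor = "nat \<Rightarrow> bool"
type_synonym str = "bool list"

subsection \<open>Computability relative to an oracle\<close>

text \<open>
  Codes for the partial recursive functions with an oracle, and their big-step semantics:
  \<open>evals A f xs y\<close> says that \<open>f\<close>, run with oracle \<open>A\<close> on the arguments \<open>xs\<close>, halts with value \<open>y\<close>.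
  No arities are imposed on codes: on argument lists of a fixed length \<open>k\<close> a code denotes a
  \<open>k\<close>-ary partial recursive function, superfluous arguments being ignored and missing ones
  leading to divergence.
\<close>

datatype code =
    Zero
  | Succ
  | Proj nat
  | Orac
  | Cmp code "code list"
  | PRec code code
  | Mu code

inductive evals :: "cantor \<Rightarrow> code \<Rightarrow> nat list \<Rightarrow> nat \<Rightarrow> bool" for A :: cantor where
  zero: "evals A Zero xs 0"
| succ: "evals A Succ (x # xs) (Suc x)"
| proj: "i < length xs \<Longrightarrow> evals A (Proj i) xs (xs ! i)"
| orac: "evals A Orac (x # xs) (if A x then 1 else 0)"
| cmp: "list_all2 (\<lambda>g y. evals A g xs y) gs ys \<Longrightarrow> evals A f ys z \<Longrightarrow> evals A (Cmp f gs) xs z"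
| prec_0: "evals A f xs y \<Longrightarrow> evals A (PRec f g) (0 # xs) y"
| prec_Suc: "evals A (PRec f g) (n # xs) y \<Longrightarrow> evals A g (n # y # xs) z
    \<Longrightarrow> evals A (PRec f g) (Suc n # xs) z"
| mu: "evals A f (n # xs) 0 \<Longrightarrow> (\<forall>m<n. \<exists>y. evals A f (m # xs) (Suc y))
    \<Longrightarrow> evals A (Mu f) xs n"

text \<open>
  The length-lexicographic bijection between strings and natural numbers: the binary expansion
  of \<open>str_code \<sigma> + 1\<close> is \<open>1\<sigma>\<close>.
\<close>

definition str_code :: "str \<Rightarrow> nat" where
  "str_code \<sigma> = foldl (\<lambda>n b. 2 * n + (if b then 2 else 1)) 0 \<sigma>"

text \<open>
  Absolute (unrelativised) computability is computability with the empty oracle, and a set is c.e.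
  if it is the domain of a partial computable function.
\<close>

definition ce :: "str set \<Rightarrow> bool" where
  "ce S \<longleftrightarrow> (\<exists>f. \<forall>\<sigma>. \<sigma> \<in> S \<longleftrightarrow> (\<exists>y. evals (\<lambda>_. False) f [str_code \<sigma>] y))"

definition uniformly_ce :: "(nat \<Rightarrow> str set) \<Rightarrow> bool" where
  "uniformly_ce S \<longleftrightarrow>
    (\<exists>f. \<forall>n \<sigma>. \<sigma> \<in> S n \<longleftrightarrow> (\<exists>y. evals (\<lambda>_. False) f [n, str_code \<sigma>] y))"

text \<open>
  Rationals are presented by the library's effective enumeration \<open>nat_to_rat_surj\<close>, which reads
  a number as a pair of an integer numerator and an integer denominator (\<open>x / 0\<close> being \<open>0\<close>).
\<close>

definition exactly_computable :: "cantor \<Rightarrow> (str \<Rightarrow> real) \<Rightarrow> bool" where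
  "exactly_computable A d \<longleftrightarrow>
    (\<exists>f. \<forall>\<sigma>. \<exists>y. evals A f [str_code \<sigma>] y \<and> d \<sigma> = of_rat (nat_to_rat_surj y))"

definition real_computable :: "cantor \<Rightarrow> (str \<Rightarrow> real) \<Rightarrow> bool" where
  "real_computable A d \<longleftrightarrow>
    (\<exists>f. \<forall>\<sigma> n. \<exists>y. evals A f [str_code \<sigma>, n] y \<and>
      \<bar>d \<sigma> - of_rat (nat_to_rat_surj y)\<bar> \<le> 1 / 2 ^ n)"

subsection \<open>Cantor space\<close>

definition uniform_measure_cantor :: "cantor measure" where
  "uniform_measure_cantor = PiM UNIV (\<lambda>_. measure_pmf (bernoulli_pmf (1/2)))"

definition seg :: "cantor \<Rightarrow> nat \<Rightarrow> str" where
  "seg X n = map X [0..<n]"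

definition open_gen :: "str set \<Rightarrow> cantor set" where
  "open_gen U = {X. \<exists>n. seg X n \<in> U}"

definition prefix_free :: "str set \<Rightarrow> bool" where
  "prefix_free U \<longleftrightarrow> (\<forall>\<sigma>\<in>U. \<forall>\<tau>\<in>U. \<not> strict_prefix \<sigma> \<tau>)"

definition ce_open :: "cantor set \<Rightarrow> bool" where
  "ce_open V \<longleftrightarrow> (\<exists>U. ce U \<and> prefix_free U \<and> V = open_gen U)"

definition uniformly_ce_open :: "(nat \<Rightarrow> cantor set) \<Rightarrow> bool" where
  "uniformly_ce_open V \<longleftrightarrow>
    (\<exists>U. uniformly_ce U \<and> (\<forall>n. prefix_free (U n) \<and> V n = open_gen (U n)))"

definition bounded_ce_open :: "cantor set \<Rightarrow> bool" where
  "bounded_ce_open V \<longleftrightarrow> ce_open V \<and> measure uniform_measure_cantor V < 1"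

subsection \<open>Randomness\<close>

definition MartinLof_test :: "(nat \<Rightarrow> cantor set) \<Rightarrow> bool" where
  "MartinLof_test V \<longleftrightarrow> decseq V \<and> uniformly_ce_open V \<and>
    (\<forall>n. measure uniform_measure_cantor (V n) \<le> 1 / 2 ^ n)"

definition passes :: "cantor \<Rightarrow> (nat \<Rightarrow> cantor set) \<Rightarrow> bool" where
  "passes X V \<longleftrightarrow> X \<notin> (\<Inter>n. V n)"

definition MLR :: "cantor set" where
  "MLR = {X. \<forall>V. MartinLof_test V \<longrightarrow> passes X V}"

definition universal_test :: "(nat \<Rightarrow> cantor set) \<Rightarrow> bool" where
  "universal_test V \<longleftrightarrow> MartinLof_test V \<and> (\<forall>X. passes X V \<longleftrightarrow> X \<in> MLR)"

definition martingale :: "(str \<Rightarrow> real) \<Rightarrow> bool" where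
  "martingale d \<longleftrightarrow>
    (\<forall>\<sigma>. 0 \<le> d \<sigma>) \<and> (\<forall>\<sigma>. d \<sigma> = (d (\<sigma> @ [False]) + d (\<sigma> @ [True])) / 2)"

definition normed :: "(str \<Rightarrow> real) \<Rightarrow> bool" where
  "normed d \<longleftrightarrow> d [] = 1"

definition succeeds :: "(str \<Rightarrow> real) \<Rightarrow> cantor \<Rightarrow> bool" where
  "succeeds d X \<longleftrightarrow> limsup (\<lambda>n. ereal (d (seg X n))) = \<infinity>"

definition CR :: "cantor \<Rightarrow> cantor set" where
  "CR A = {X. \<forall>d. martingale d \<and> real_computable A d \<longrightarrow> \<not> succeeds d X}"

definition High :: "(cantor \<Rightarrow> cantor set) \<Rightarrow> cantor set \<Rightarrow> cantor set" where
  "High C D = {A. C A \<subseteq> D}"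

definition minimal_for :: "(str \<Rightarrow> bool) \<Rightarrow> str \<Rightarrow> bool" where
  "minimal_for P \<sigma> \<longleftrightarrow> P \<sigma> \<and> (\<forall>\<tau>. strict_prefix \<tau> \<sigma> \<longrightarrow> \<not> P \<tau>)"

definition winning_open :: "cantor \<Rightarrow> cantor set \<Rightarrow> bool" where
  "winning_open A V \<longleftrightarrow>
    (\<exists>d (q :: rat). martingale d \<and> normed d \<and> exactly_computable A d \<and> q > 1 \<and>
      V = open_gen {\<sigma>. minimal_for (\<lambda>\<tau>. d \<tau> \<ge> of_rat q) \<sigma>})"

end

theory Submission
  imports Defs
begin

text \<open>
  That the fourth statement implies the first is immediate, and the second implies the third because
  the first level of a test has measure at most one half. The other two implications carry the
  proof.

  From the third statement to the fourth: let \<open>d\<close> win at least the factor \<open>q > 1\<close> on every sequence in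
  the first level. If \<open>X\<close> is not random, then no tail of \<open>X\<close> is (\<open>not_MLR_tail\<close>), so by universality
  every tail lies in the first level. Hence \<open>d\<close>, restarted with the accumulated capital after
  every win, multiplies its capital by \<open>q\<close> infinitely often along \<open>X\<close> (\<open>restarted_martingale\<close>).

  From the first statement to the second, by contraposition: let \<open>S\<close> be a c.e. prefix-free set whose open
  set has measure \<open>m < 1\<close> and is covered by no winning open set. The sequences that begin with \<open>n\<close>
  consecutive blocks from \<open>S\<close> form a c.e. open set of measure \<open>m ^ n\<close>, so infinite concatenations of
  blocks are not random (\<open>not_MLR_if_all_concat_powers\<close>). On the other hand, after any string and for any
  exactly computable martingale, some block keeps the martingale from growing by more than a
  prescribed amount, for otherwise its winning open set would cover (\<open>uncovered_extension\<close>). Adding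
  the countably many exactly computable martingales one after the other, with small weights, to the
  martingale against which the blocks are chosen gives a sequence on which none of them succeeds
  (\<open>uncovered_not_High\<close>). A computable martingale with real values is dominated by an exactly
  computable one (\<open>real_computable_dominated\<close>).

  The effectiveness claims rest on a calculus of computable functions on numbers, pairs and strings,
  obtained from the codes, and on a step-counting version of the semantics, by which the powers of
  a c.e. set are seen to be uniformly c.e. (\<open>semidecidable_concat_power\<close>).
\<close>

section \<open>Total functions on argument lists\<close>

text \<open>
  Codes carry no arity, so a code is said to compute a total function on the argument lists of one
  fixed length.
\<close>

definition total_computable :: "cantor \<Rightarrow> nat \<Rightarrow> (nat list \<Rightarrow> nat) \<Rightarrow> bool" where
  "total_computable A k F \<longleftrightarrow> (\<exists>f. \<forall>xs. length xs = k \<longrightarrow> evals A f xs (F xs))"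

text \<open>
  Vectors of functions are what gets substituted into a function; treating the whole vector as one
  list-valued function makes dropping and inserting arguments uniform in their number.
\<close>

definition total_computables :: "cantor \<Rightarrow> nat \<Rightarrow> nat \<Rightarrow> (nat list \<Rightarrow> nat list) \<Rightarrow> bool" where
  "total_computables A k m G \<longleftrightarrow>
    (\<exists>gs. length gs = m \<and> (\<forall>xs. length xs = k \<longrightarrow> list_all2 (\<lambda>g y. evals A g xs y) gs (G xs)))"

lemma total_computable_cong:
  assumes "total_computable A k F" "\<And>xs. length xs = k \<Longrightarrow> F xs = G xs"
  shows "total_computable A k G"
  using assms unfolding total_computable_def by metis

lemma total_computables_Nil: "total_computables A k 0 (\<lambda>xs. [])"
  unfolding total_computables_def by auto

lemma total_computables_Cons:
  assumes "total_computable A k F" "total_computables A k m G"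
  shows "total_computables A k (Suc m) (\<lambda>xs. F xs # G xs)"
proof -
  obtain f gs where "\<And>xs. length xs = k \<Longrightarrow> evals A f xs (F xs)" "length gs = m"
      "\<And>xs. length xs = k \<Longrightarrow> list_all2 (\<lambda>g y. evals A g xs y) gs (G xs)"
    using assms unfolding total_computable_def total_computables_def by blast
  then show ?thesis
    unfolding total_computables_def by (intro exI[of _ "f # gs"]) auto
qed

lemma total_computables_map:
  assumes "\<And>g. g \<in> set gs \<Longrightarrow> total_computable A k (F g)"
  shows "total_computables A k (length gs) (\<lambda>xs. map (\<lambda>g. F g xs) gs)"
  using assms
proof (induction gs)
  case (Cons g gs)
  then show ?case using total_computables_Cons[of A k "F g"] by simp
qed (simp add: total_computables_Nil)

lemma total_computable_comp:
  assumes "total_computable A m F" "total_computables A k m G"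
  shows "total_computable A k (\<lambda>xs. F (G xs))"
proof -
  obtain f gs where *: "\<And>xs. length xs = m \<Longrightarrow> evals A f xs (F xs)" "length gs = m"
      "\<And>xs. length xs = k \<Longrightarrow> list_all2 (\<lambda>g y. evals A g xs y) gs (G xs)"
    using assms unfolding total_computable_def total_computables_def by blast
  have "evals A (Cmp f gs) xs (F (G xs))" if "length xs = k" for xs
    using *(1)[of "G xs"] *(3)[OF that] *(2) by (auto intro!: evals.cmp dest: list_all2_lengthD)
  then show ?thesis unfolding total_computable_def by blast
qed

lemma total_computable_proj: "i < k \<Longrightarrow> total_computable A k (\<lambda>xs. xs ! i)"
  unfolding total_computable_def by (metis evals.proj)

lemma total_computable_hd: "total_computable A (Suc k) hd"
  by (rule total_computable_cong[OF total_computable_proj[of 0]]) (auto simp: length_Suc_conv)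

text \<open>
  Reordering arguments is composition with projections. This form passes on all remaining
  parameters at once, which recursion and search need.
\<close>

lemma total_computables_drop:
  assumes "m + j = k" shows "total_computables A k m (drop j)"
proof -
  have *: "total_computables A k m (\<lambda>xs. map (\<lambda>i. xs ! (i + j)) [0..<m])"
    using total_computables_map[of "[0..<m]" A k "\<lambda>i xs. xs ! (i + j)"] assms
    by (simp add: total_computable_proj)
  have "map (\<lambda>i. xs ! (i + j)) [0..<m] = drop j xs" if "length xs = k" for xs :: "nat list"
    using that assms by (intro nth_equalityI) (auto simp: add.commute)
  with * show ?thesis unfolding total_computables_def by simp
qed

lemma total_computables_id: "total_computables A k k (\<lambda>xs. xs)"
  using total_computables_drop[of k 0 k A] by (simp add: drop_0[abs_def])

lemma total_computables_tl: "total_computables A (Suc k) k tl"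
  using total_computables_drop[of k 1 "Suc k" A] by (simp add: drop_Suc[abs_def])

lemma total_computable_Suc:
  assumes "total_computable A k F" shows "total_computable A k (\<lambda>xs. Suc (F xs))"
proof -
  have "total_computable A 1 (\<lambda>xs. Suc (hd xs))"
    unfolding total_computable_def
    by (intro exI[of _ Succ]) (auto simp: length_Suc_conv intro: evals.succ)
  from total_computable_comp[OF this total_computables_Cons[OF assms total_computables_Nil,
      unfolded One_nat_def[symmetric]]]
  show ?thesis by simp
qed

lemma total_computable_const: "total_computable A k (\<lambda>xs. c)"
proof (induction c)
  case 0 show ?case unfolding total_computable_def by (metis evals.zero)
qed (rule total_computable_Suc)

lemma total_computable_oracle:
  assumes "total_computable A k F" shows "total_computable A k (\<lambda>xs. if A (F xs) then 1 else 0)"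
proof -
  have "evals A Orac xs (if A (hd xs) then 1 else 0)" if "length xs = 1" for xs
    using that evals.orac[of A "hd xs" "tl xs"] by (cases xs) auto
  then have "total_computable A 1 (\<lambda>xs. if A (hd xs) then 1 else 0)"
    unfolding total_computable_def by blast
  from total_computable_comp[OF this total_computables_Cons[OF assms total_computables_Nil,
      unfolded One_nat_def[symmetric]]]
  show ?thesis by simp
qed

lemma total_computable_rec:
  assumes Z: "total_computable A k Z" and S: "total_computable A (Suc (Suc k)) S"
    and N: "total_computable A k N"
  shows "total_computable A k (\<lambda>xs. rec_nat (Z xs) (\<lambda>n r. S (n # r # xs)) (N xs))"
proof -
  obtain z s where z: "\<And>xs. length xs = k \<Longrightarrow> evals A z xs (Z xs)"
    and s: "\<And>xs. length xs = Suc (Suc k) \<Longrightarrow> evals A s xs (S xs)"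
    using Z S unfolding total_computable_def by blast
  have "evals A (PRec z s) (n # xs) (rec_nat (Z xs) (\<lambda>n r. S (n # r # xs)) n)"
    if "length xs = k" for n xs
    by (induction n) (auto intro!: evals.prec_0 evals.prec_Suc z s that)
  then have "total_computable A (Suc k) (\<lambda>xs. rec_nat (Z (tl xs)) (\<lambda>n r. S (n # r # tl xs)) (hd xs))"
    unfolding total_computable_def by (intro exI[of _ "PRec z s"]) (auto simp: length_Suc_conv)
  from total_computable_comp[OF this total_computables_Cons[OF N total_computables_id]]
  show ?thesis by simp
qed

lemma total_computable_Least:
  assumes F: "total_computable A (Suc k) F"
    and ex: "\<And>xs. length xs = k \<Longrightarrow> \<exists>n. F (n # xs) = 0"
  shows "total_computable A k (\<lambda>xs. LEAST n. F (n # xs) = 0)"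
proof -
  obtain f where f: "\<And>xs. length xs = Suc k \<Longrightarrow> evals A f xs (F xs)"
    using F unfolding total_computable_def by blast
  have "evals A (Mu f) xs (LEAST n. F (n # xs) = 0)" (is "evals A _ _ ?n") if "length xs = k" for xs
  proof (rule evals.mu)
    show "evals A f (?n # xs) 0"
      using f[of "?n # xs"] LeastI_ex[OF ex[OF that]] that by simp
    show "\<forall>m<?n. \<exists>y. evals A f (m # xs) (Suc y)"
      using f[of "_ # xs"] not_less_Least that by (metis length_Cons not0_implies_Suc)
  qed
  then show ?thesis unfolding total_computable_def by blast
qed

lemmas total_computable_unary =
  total_computable_comp[OF _ total_computables_Cons[OF _ total_computables_Nil]]

lemma total_computable_pred:
  assumes "total_computable A k F" shows "total_computable A k (\<lambda>xs. F xs - 1)"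
proof -
  have "rec_nat 0 (\<lambda>n r. n) m = m - 1" for m :: nat by (cases m) auto
  then show ?thesis
    using total_computable_rec[OF total_computable_const[of A k 0] total_computable_hd assms] by simp
qed

lemma total_computable_add:
  assumes "total_computable A k F" "total_computable A k G"
  shows "total_computable A k (\<lambda>xs. F xs + G xs)"
proof -
  have "rec_nat a (\<lambda>n r. Suc r) m = a + m" for a m :: nat by (induction m) auto
  moreover have "total_computable A (Suc (Suc k)) (\<lambda>xs. Suc (xs ! 1))"
    by (intro total_computable_Suc total_computable_proj) simp
  ultimately show ?thesis
    using total_computable_rec[OF assms(1) _ assms(2), of "\<lambda>xs. Suc (xs ! 1)"] by simp
qed

lemma total_computable_diff:
  assumes "total_computable A k F" "total_computable A k G"
  shows "total_computable A k (\<lambda>xs. F xs - G xs)"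
proof -
  have "rec_nat a (\<lambda>n r. r - 1) m = a - m" for a m :: nat by (induction m) auto
  moreover have "total_computable A (Suc (Suc k)) (\<lambda>xs. xs ! 1 - 1)"
    by (intro total_computable_pred total_computable_proj) simp
  ultimately show ?thesis
    using total_computable_rec[OF assms(1) _ assms(2), of "\<lambda>xs. xs ! 1 - 1"] by simp
qed

lemma total_computable_triangle:
  assumes "total_computable A k F" shows "total_computable A k (\<lambda>xs. triangle (F xs))"
proof -
  have "rec_nat 0 (\<lambda>n r. r + Suc n) m = triangle m" for m :: nat by (induction m) auto
  moreover have "total_computable A (Suc (Suc k)) (\<lambda>xs. xs ! 1 + Suc (xs ! 0))"
    by (intro total_computable_add total_computable_Suc total_computable_proj) simp_all
  ultimately show ?thesis
    using total_computable_rec[OF total_computable_const[of A k 0] _ assms,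
        of "\<lambda>xs. xs ! 1 + Suc (xs ! 0)"] by simp
qed

lemma total_computable_prod_encode:
  assumes "total_computable A k F" "total_computable A k G"
  shows "total_computable A k (\<lambda>xs. prod_encode (F xs, G xs))"
  unfolding prod_encode_def
  by (simp del: triangle_Suc) (intro total_computable_add total_computable_triangle assms)

text \<open>
  The diagonal on which \<open>n\<close> lies is the least \<open>s\<close> with \<open>n < triangle (s + 1)\<close>; both components of
  the pair coded by \<open>n\<close> are determined by it.
\<close>

lemma Least_triangle:
  "(LEAST s. Suc n - triangle (Suc s) = 0) = fst (prod_decode n) + snd (prod_decode n)"
proof -
  obtain a b where ab: "prod_decode n = (a, b)" by (cases "prod_decode n")
  then have n: "n = triangle (a + b) + a"
    using prod_decode_inverse[of n] by (simp add: prod_encode_def)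
  have mono: "mono triangle"
    by (simp add: mono_iff_le_Suc)
  have "(LEAST s. Suc n - triangle (Suc s) = 0) = a + b"
  proof (rule Least_equality)
    show "Suc n - triangle (Suc (a + b)) = 0" by (simp add: n)
    fix s assume *: "Suc n - triangle (Suc s) = 0"
    show "a + b \<le> s"
    proof (rule ccontr)
      assume "\<not> a + b \<le> s"
      then have "triangle (Suc s) \<le> triangle (a + b)" by (intro monoD[OF mono]) simp
      with * n show False by linarith
    qed
  qed
  then show ?thesis by (simp add: ab)
qed

lemma total_computable_prod_decode_sum:
  assumes "total_computable A k F"
  shows "total_computable A k (\<lambda>xs. fst (prod_decode (F xs)) + snd (prod_decode (F xs)))"
proof -
  have "total_computable A (Suc 1) (\<lambda>xs. Suc (xs ! 1) - triangle (Suc (xs ! 0)))"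
    by (intro total_computable_diff total_computable_triangle total_computable_Suc
        total_computable_proj) auto
  moreover have "\<exists>n. Suc ((n # xs) ! 1) - triangle (Suc ((n # xs) ! 0)) = 0" for xs
    by (intro exI[of _ "xs ! 0"]) simp
  ultimately have "total_computable A 1
      (\<lambda>xs. LEAST n. Suc ((n # xs) ! 1) - triangle (Suc ((n # xs) ! 0)) = 0)"
    by (rule total_computable_Least)
  then have "total_computable A 1 (\<lambda>xs. fst (prod_decode (xs ! 0)) + snd (prod_decode (xs ! 0)))"
    by (simp only: Least_triangle nth_Cons_0 nth_Cons_Suc One_nat_def)
  from total_computable_unary[OF this[unfolded One_nat_def] assms]
  show ?thesis by simp
qed

lemma total_computable_fst_prod_decode:
  assumes "total_computable A k F" shows "total_computable A k (\<lambda>xs. fst (prod_decode (F xs)))"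
proof -
  have "n - triangle (fst (prod_decode n) + snd (prod_decode n)) = fst (prod_decode n)" for n
  proof -
    obtain a b where "prod_decode n = (a, b)" by (cases "prod_decode n")
    then show ?thesis using prod_decode_inverse[of n] by (simp add: prod_encode_def)
  qed
  then show ?thesis
    using total_computable_diff[OF assms
        total_computable_triangle[OF total_computable_prod_decode_sum[OF assms]]]
    by simp
qed

lemma total_computable_snd_prod_decode:
  assumes "total_computable A k F" shows "total_computable A k (\<lambda>xs. snd (prod_decode (F xs)))"
  using total_computable_diff[OF total_computable_prod_decode_sum[OF assms]
      total_computable_fst_prod_decode[OF assms]] by simp

section \<open>Computable functions on numbers, pairs and strings\<close>

text \<open>
  A computable function is to be given by a code that sends the code of every argument to the code
  of its value. With the encoding as a class parameter, one set of closure rules serves numbers,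
  truth values, pairs and strings, and recursion may carry any of them as its state.
\<close>

class coded =
  fixes encode :: "'a \<Rightarrow> nat"

instantiation nat :: coded
begin
definition encode_nat_def [simp]: "encode (n::nat) = n"
instance ..
end

instantiation bool :: coded
begin
definition encode_bool_def [simp]: "encode (b::bool) = of_bool b"
instance ..
end

instantiation prod :: (coded, coded) coded
begin
definition encode_prod_def: "encode (p :: 'a \<times> 'b) = prod_encode (encode (fst p), encode (snd p))"
instance ..
end

text \<open>
  The fold is the length-lexicographic code of strings, with the bit replaced by the code of the
  element so that it makes sense over every coded type.
\<close>

instantiation list :: (coded) coded
begin
definition encode_list_def: "encode (xs :: 'a list) = foldl (\<lambda>n b. 2 * n + (1 + encode b)) 0 xs"
instance ..
end

lemma encode_str: "encode (\<sigma> :: str) = str_code \<sigma>"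
proof -
  have "(\<lambda>n b. 2 * n + (1 + encode b)) = (\<lambda>n b. 2 * n + (if b then 2 else 1))"
    by (intro ext) simp
  then show ?thesis by (simp only: encode_list_def str_code_def)
qed

lemma encode_Nil [simp]: "encode [] = 0"
  by (simp add: encode_list_def)

lemma encode_snoc [simp]: "encode (xs @ [x]) = 2 * encode xs + (1 + encode x)"
  by (simp add: encode_list_def)

definition computable :: "cantor \<Rightarrow> ('a::coded \<Rightarrow> 'b::coded) \<Rightarrow> bool" where
  "computable A f \<longleftrightarrow> (\<exists>c. \<forall>x. evals A c [encode x] (encode (f x)))"

lemma computable_id: "computable A (\<lambda>x. x)"
  unfolding computable_def using evals.proj[of 0 "[_]" A] by auto

lemma computable_comp:
  assumes "computable A f" "computable A g" shows "computable A (\<lambda>x. f (g x))"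
proof -
  obtain c e where ce: "\<And>x. evals A c [encode x] (encode (f x))" "\<And>x. evals A e [encode x] (encode (g x))"
    using assms unfolding computable_def by blast
  then have "evals A (Cmp c [e]) [encode x] (encode (f (g x)))" for x
    by (intro evals.cmp[where ys = "[encode (g x)]"]) auto
  then show ?thesis unfolding computable_def by blast
qed

text \<open>
  Numbers code themselves, so a value may be exchanged for its code. This reduces claims about
  strings and truth values to arithmetic on their codes.
\<close>

lemma computable_encode_iff: "computable A (\<lambda>x. encode (f x)) \<longleftrightarrow> computable A f"
  unfolding computable_def by simp

lemma computable_encode: "computable A f \<Longrightarrow> computable A (\<lambda>x. encode (f x))"
  by (simp add: computable_encode_iff)

lemma computableI_total:
  assumes "total_computable A 1 F" "\<And>x. encode (f x) = F [encode x]"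
  shows "computable A f"
proof -
  obtain c where "\<And>xs. length xs = 1 \<Longrightarrow> evals A c xs (F xs)"
    using assms(1) unfolding total_computable_def by blast
  then have "evals A c [encode x] (F [encode x])" for x by simp
  then show ?thesis unfolding computable_def assms(2) by blast
qed

lemma total_computable_arg: "total_computable A 1 (\<lambda>xs. xs ! 0)"
  by (rule total_computable_proj) simp

named_theorems computable_intros
declare computable_id [computable_intros]

lemma computable_const [computable_intros]: "computable A (\<lambda>x. c)"
  by (rule computableI_total[OF total_computable_const[of A 1 "encode c"]]) simp

lemma computable_fst [computable_intros]:
  assumes "computable A f" shows "computable A (\<lambda>x. fst (f x))"
proof -
  have "computable A (fst :: 'b \<times> 'c \<Rightarrow> 'b)"
    by (rule computableI_total[OF total_computable_fst_prod_decode[OF total_computable_arg]])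
      (simp add: encode_prod_def)
  from computable_comp[OF this assms] show ?thesis .
qed

lemma computable_snd [computable_intros]:
  assumes "computable A f" shows "computable A (\<lambda>x. snd (f x))"
proof -
  have "computable A (snd :: 'b \<times> 'c \<Rightarrow> 'c)"
    by (rule computableI_total[OF total_computable_snd_prod_decode[OF total_computable_arg]])
      (simp add: encode_prod_def)
  from computable_comp[OF this assms] show ?thesis .
qed

lemma computable_Pair [computable_intros]:
  assumes "computable A f" "computable A g" shows "computable A (\<lambda>x. (f x, g x))"
proof -
  obtain c e where c: "\<And>x. evals A c [encode x] (encode (f x))"
    and e: "\<And>x. evals A e [encode x] (encode (g x))"
    using assms unfolding computable_def by blast
  have "total_computable A 2 (\<lambda>xs. prod_encode (xs ! 0, xs ! 1))"
    by (intro total_computable_prod_encode total_computable_proj) auto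
  then obtain p where "\<And>xs. length xs = 2 \<Longrightarrow> evals A p xs (prod_encode (xs ! 0, xs ! 1))"
    unfolding total_computable_def by blast
  from this[of "[_, _]"] have "evals A p [a, b] (prod_encode (a, b))" for a b by simp
  then have "evals A (Cmp p [c, e]) [encode x] (encode (f x, g x))" for x
    using c[of x] e[of x]
    by (intro evals.cmp[where ys = "[encode (f x), encode (g x)]"]) (auto simp: encode_prod_def)
  then show ?thesis unfolding computable_def by blast
qed

lemma computable_Suc [computable_intros]:
  assumes "computable A f" shows "computable A (\<lambda>x. Suc (f x))"
proof -
  have "computable A Suc"
    by (rule computableI_total[OF total_computable_Suc[OF total_computable_arg]]) simp
  from computable_comp[OF this assms] show ?thesis .
qed

text \<open>
  The recursion takes place on codes: the step receives the counter, the code of the previous value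
  and the code of the parameter as three arguments and first packs them into the code of a triple.
\<close>

lemma computable_rec [computable_intros]:
  fixes z :: "'a::coded \<Rightarrow> 'b::coded"
  assumes z: "computable A z" and s: "computable A (\<lambda>p. s (fst p) (fst (snd p)) (snd (snd p)))"
    and m: "computable A m"
  shows "computable A (\<lambda>x. rec_nat (z x) (s x) (m x))"
proof -
  obtain cz cm where cz: "\<And>x. evals A cz [encode x] (encode (z x))"
    and cm: "\<And>x. evals A cm [encode x] (encode (m x))"
    using z m unfolding computable_def by blast
  obtain cs where "\<And>p. evals A cs [encode p] (encode (s (fst p) (fst (snd p)) (snd (snd p))))"
    using s unfolding computable_def by blast
  then have cs: "evals A cs [encode (x, n, r)] (encode (s x n r))" for x n r
    by (metis fst_conv snd_conv)
  have "total_computable A 3 (\<lambda>xs. prod_encode (xs ! 2, prod_encode (xs ! 0, xs ! 1)))"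
    by (intro total_computable_prod_encode total_computable_proj) auto
  then obtain p where "\<And>xs. length xs = 3 \<Longrightarrow>
      evals A p xs (prod_encode (xs ! 2, prod_encode (xs ! 0, xs ! 1)))"
    unfolding total_computable_def by blast
  from this[of "[_, _, _]"]
  have p: "evals A p [n, encode r, encode x] (encode (x, n, r))" for x :: 'a and n and r :: 'b
    by (simp add: encode_prod_def)
  have step: "evals A (Cmp cs [p]) [n, encode r, encode x] (encode (s x n r))" for x n r
    using p[of n r x] cs by (intro evals.cmp[where ys = "[encode (x, n, r)]"]) auto
  have rec: "evals A (PRec cz (Cmp cs [p])) [n, encode x] (encode (rec_nat (z x) (s x) n))" for x n
  proof (induction n)
    case 0 show ?case by (simp add: evals.prec_0 cz)
  next
    case (Suc n) then show ?case using evals.prec_Suc[OF Suc step] by simp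
  qed
  have "evals A (Cmp (PRec cz (Cmp cs [p])) [cm, Proj 0]) [encode x]
      (encode (rec_nat (z x) (s x) (m x)))" for x
    using cm[of x] evals.proj[of 0 "[encode x]" A] rec
    by (intro evals.cmp[where ys = "[m x, encode x]"]) auto
  then show ?thesis unfolding computable_def by blast
qed

lemma computable_If [computable_intros]:
  assumes "computable A b" "computable A f" "computable A g"
  shows "computable A (\<lambda>x. if b x then f x else g x)"
proof -
  have "computable A (\<lambda>x. rec_nat (g x) (\<lambda>_ _. f x) (encode (b x)))"
    by (intro computable_rec assms computable_encode computable_comp[OF assms(2)] computable_intros)
  moreover have "rec_nat (g x) (\<lambda>_ _. f x) (encode (b x)) = (if b x then f x else g x)" for x
    by simp
  ultimately show ?thesis by simp
qed

lemma computable_pred: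
  assumes "computable A f" shows "computable A (\<lambda>x. f x - 1 :: nat)"
proof -
  have "computable A (\<lambda>x. rec_nat 0 (\<lambda>n _. n) (f x))"
    by (intro computable_intros assms)
  moreover have "rec_nat 0 (\<lambda>n _. n) n = n - 1" for n :: nat by (cases n) auto
  ultimately show ?thesis by simp
qed

lemma computable_add [computable_intros]:
  assumes "computable A f" "computable A g" shows "computable A (\<lambda>x. f x + g x :: nat)"
proof -
  have "computable A (\<lambda>x. rec_nat (f x) (\<lambda>_ r. Suc r) (g x))"
    by (intro computable_intros assms)
  moreover have "rec_nat a (\<lambda>_ r. Suc r) n = a + n" for a n :: nat by (induction n) auto
  ultimately show ?thesis by simp
qed

lemma computable_mult [computable_intros]:
  assumes "computable A f" "computable A g" shows "computable A (\<lambda>x. f x * g x :: nat)"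
proof -
  have "computable A (\<lambda>x. rec_nat 0 (\<lambda>_ r. r + f x) (g x))"
    by (intro computable_intros assms computable_comp[OF assms(1)])
  moreover have "rec_nat 0 (\<lambda>_ r. r + a) n = a * n" for a n :: nat by (induction n) auto
  ultimately show ?thesis by simp
qed

lemma computable_diff [computable_intros]:
  assumes "computable A f" "computable A g" shows "computable A (\<lambda>x. f x - g x :: nat)"
proof -
  have "computable A (\<lambda>x. rec_nat (f x) (\<lambda>_ r. r - 1) (g x))"
    by (intro computable_rec computable_pred computable_intros assms)
  moreover have "rec_nat a (\<lambda>_ r. r - 1) n = a - n" for a n :: nat by (induction n) auto
  ultimately show ?thesis by simp
qed

lemma computable_eq_0:
  assumes "computable A f" shows "computable A (\<lambda>x. f x = (0::nat))"
proof -
  have "computable A (\<lambda>x. rec_nat True (\<lambda>_ _. False) (f x))"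
    by (intro computable_intros assms)
  moreover have "rec_nat True (\<lambda>_ _. False) n = (n = 0)" for n by (cases n) auto
  ultimately show ?thesis by simp
qed

lemma computable_not [computable_intros]:
  assumes "computable A b" shows "computable A (\<lambda>x. \<not> b x)"
proof -
  have "computable A (\<lambda>x. if b x then False else True)" by (intro computable_intros assms)
  also have "(\<lambda>x. if b x then False else True) = (\<lambda>x. \<not> b x)" by auto
  finally show ?thesis .
qed

lemma computable_conj [computable_intros]:
  assumes "computable A b" "computable A c" shows "computable A (\<lambda>x. b x \<and> c x)"
proof -
  have "computable A (\<lambda>x. if b x then c x else False)" by (intro computable_intros assms)
  also have "(\<lambda>x. if b x then c x else False) = (\<lambda>x. b x \<and> c x)" by auto
  finally show ?thesis .
qed

lemma computable_le [computable_intros]: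
  assumes "computable A f" "computable A g" shows "computable A (\<lambda>x. f x \<le> (g x :: nat))"
  using computable_eq_0[OF computable_diff[OF assms]] by simp

lemma computable_eq [computable_intros]:
  assumes "computable A f" "computable A g" shows "computable A (\<lambda>x. f x = (g x :: nat))"
  using computable_conj[OF computable_le[OF assms] computable_le[OF assms(2,1)]]
  by (simp add: eq_iff)

lemma computable_even [computable_intros]:
  assumes "computable A f" shows "computable A (\<lambda>x. even (f x :: nat))"
proof -
  have "computable A (\<lambda>x. rec_nat True (\<lambda>_ r. \<not> r) (f x))"
    by (intro computable_intros assms)
  moreover have "rec_nat True (\<lambda>_ r. \<not> r) n = even n" for n by (induction n) auto
  ultimately show ?thesis by simp
qed

lemma computable_half [computable_intros]:
  assumes "computable A f" shows "computable A (\<lambda>x. f x div 2 :: nat)"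
proof -
  have "computable A (\<lambda>x. rec_nat 0 (\<lambda>n r. if even n then r else Suc r) (f x))"
    by (intro computable_intros assms)
  moreover have "rec_nat 0 (\<lambda>n r. if even n then r else Suc r) n = n div 2" for n :: nat
  proof (induction n)
    case (Suc n) then show ?case by (cases "even n") (auto elim!: evenE oddE)
  qed simp
  ultimately show ?thesis by simp
qed

lemma computable_Least:
  fixes P :: "'a::coded \<Rightarrow> nat \<Rightarrow> bool"
  assumes P: "computable A (\<lambda>p. P (fst p) (snd p))" and ex: "\<And>x. \<exists>n. P x n"
  shows "computable A (\<lambda>x. LEAST n. P x n)"
proof -
  have "computable A (\<lambda>p. \<not> P (fst p) (snd p))" by (intro computable_not P)
  then obtain c where c: "\<And>p. evals A c [encode p] (encode (\<not> P (fst p) (snd p)))"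
    unfolding computable_def by blast
  have "total_computable A 2 (\<lambda>xs. prod_encode (xs ! 1, xs ! 0))"
    by (intro total_computable_prod_encode total_computable_proj) auto
  then obtain p where "\<And>xs. length xs = 2 \<Longrightarrow> evals A p xs (prod_encode (xs ! 1, xs ! 0))"
    unfolding total_computable_def by blast
  from this[of "[_, _]"] have p: "evals A p [n, encode x] (encode (x, n))" for x :: 'a and n
    by (simp add: encode_prod_def)
  have step: "evals A (Cmp c [p]) [n, encode x] (encode (\<not> P x n))" for n x
    using c[of "(x, n)"] p[of n x] by (intro evals.cmp[where ys = "[encode (x, n)]"]) auto
  have "evals A (Mu (Cmp c [p])) [encode x] (LEAST n. P x n)" for x
  proof (rule evals.mu)
    show "evals A (Cmp c [p]) [LEAST n. P x n, encode x] 0"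
      using step[of "LEAST n. P x n" x] LeastI_ex[OF ex[of x]] by simp
    show "\<forall>m<LEAST n. P x n. \<exists>y. evals A (Cmp c [p]) [m, encode x] (Suc y)"
      using step[of _ x] not_less_Least[of _ "P x"] by (metis encode_bool_def of_bool_eq(2) One_nat_def)
  qed
  then show ?thesis unfolding computable_def encode_nat_def by blast
qed

subsection \<open>Strings\<close>

lemma computable_snoc [computable_intros]:
  assumes "computable A f" "computable A g" shows "computable A (\<lambda>x. f x @ [g x])"
proof -
  have "computable A (\<lambda>x. encode (f x) + encode (f x) + (1 + encode (g x)))"
    by (intro computable_intros computable_encode assms)
  also have "(\<lambda>x. encode (f x) + encode (f x) + (1 + encode (g x))) = (\<lambda>x. encode (f x @ [g x]))"
    by (intro ext) simp
  finally show ?thesis by (simp only: computable_encode_iff)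
qed

lemma encode_butlast: "encode (butlast \<sigma>) = (encode \<sigma> - 1) div 2" for \<sigma> :: str
  by (cases \<sigma> rule: rev_cases) auto

text \<open>
  Removing the last bit of a string turns its code \<open>n\<close> into \<open>(n - 1) div 2\<close>, and the removed bit was
  \<open>True\<close> iff \<open>n\<close> is even and positive. So bits are counted from the right end here.
\<close>

definition code_bit :: "nat \<Rightarrow> nat \<Rightarrow> bool" where
  "code_bit n i \<longleftrightarrow> 0 < (((\<lambda>n. (n - 1) div 2) ^^ i) n) \<and> even (((\<lambda>n. (n - 1) div 2) ^^ i) n)"

lemma funpow_butlast_code:
  "((\<lambda>n. (n - 1) div 2) ^^ i) (encode \<sigma>) = encode (take (length \<sigma> - i) \<sigma>)" for \<sigma> :: str
proof (induction i)
  case (Suc i)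
  then show ?case using encode_butlast[of "take (length \<sigma> - i) \<sigma>", symmetric]
    by (simp add: butlast_take)
qed simp

lemma code_bit_encode:
  fixes \<sigma> :: str
  assumes "i < length \<sigma>" shows "code_bit (encode \<sigma>) (length \<sigma> - Suc i) = \<sigma> ! i"
proof -
  have "take (length \<sigma> - (length \<sigma> - Suc i)) \<sigma> = take i \<sigma> @ [\<sigma> ! i]"
    using assms by (simp add: take_Suc_conv_app_nth)
  then show ?thesis unfolding code_bit_def funpow_butlast_code by simp
qed

lemma computable_funpow_halve:
  assumes "computable A f" "computable A g"
  shows "computable A (\<lambda>x. ((\<lambda>n. (n - 1) div 2) ^^ f x) (g x) :: nat)"
proof -
  have "computable A (\<lambda>x. rec_nat (g x) (\<lambda>_ r. (r - 1) div 2) (f x))"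
    by (intro computable_intros assms)
  moreover have "rec_nat a (\<lambda>_ r. (r - 1) div 2) n = ((\<lambda>n. (n - 1) div 2) ^^ n) a" for a n :: nat
    by (induction n) auto
  ultimately show ?thesis by simp
qed

lemma computable_code_bit [computable_intros]:
  assumes "computable A f" "computable A g" shows "computable A (\<lambda>x. code_bit (f x) (g x))"
proof -
  have "computable A (\<lambda>x. \<not> ((\<lambda>n. (n - 1) div 2) ^^ g x) (f x) = 0
      \<and> even (((\<lambda>n. (n - 1) div 2) ^^ g x) (f x)))"
    by (intro computable_intros computable_funpow_halve assms)
  then show ?thesis unfolding code_bit_def by simp
qed

text \<open>
  The length is the number of bits that can be removed before the code becomes \<open>0\<close>.
\<close>

lemma computable_length [computable_intros]:
  assumes "computable A f" shows "computable A (\<lambda>x. length (f x :: str))"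
proof -
  have 1: "computable A (\<lambda>\<sigma> :: str. LEAST i. ((\<lambda>n. (n - 1) div 2) ^^ i) (encode \<sigma>) = 0)"
  proof (rule computable_Least)
    show "computable A (\<lambda>p. ((\<lambda>n. (n - 1) div 2) ^^ (snd p)) (encode (fst p :: str)) = 0)"
      by (intro computable_intros computable_funpow_halve computable_encode)
  next
    fix \<sigma> :: str
    show "\<exists>i. ((\<lambda>n. (n - 1) div 2) ^^ i) (encode \<sigma>) = 0"
      by (intro exI[of _ "length \<sigma>"]) (simp only: funpow_butlast_code, simp)
  qed
  have eq: "encode \<sigma> = 0 \<longleftrightarrow> \<sigma> = []" for \<sigma> :: str by (cases \<sigma> rule: rev_cases) auto
  have "(LEAST i. ((\<lambda>n. (n - 1) div 2) ^^ i) (encode \<sigma>) = 0) = length \<sigma>" for \<sigma> :: str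
    unfolding funpow_butlast_code eq by (rule Least_equality) auto
  with 1 have "computable A (length :: str \<Rightarrow> nat)" by simp
  from computable_comp[OF this assms] show ?thesis .
qed

text \<open>
  Codes can only be taken apart from the right end, so a left fold is run by a recursion that looks
  each bit up by its position.
\<close>

lemma computable_foldl [computable_intros]:
  assumes s: "computable A (\<lambda>p. s (fst p) (fst (snd p)) (snd (snd p)))"
    and z: "computable A z" and l: "computable A l"
  shows "computable A (\<lambda>x. foldl (s x) (z x) (l x :: str))"
proof -
  let ?step = "\<lambda>x i r. s x r (code_bit (encode (l x)) (length (l x) - Suc i))"
  have "computable A (\<lambda>p. ?step (fst p) (fst (snd p)) (snd (snd p)))"
  proof -
    have "computable A (\<lambda>p :: 'a \<times> nat \<times> 'b. (fst p, snd (snd p),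
        code_bit (encode (l (fst p))) (length (l (fst p)) - Suc (fst (snd p)))))"
      by (intro computable_intros computable_encode computable_comp[OF l])
    from computable_comp[OF s this] show ?thesis by simp
  qed
  then have "computable A (\<lambda>x. rec_nat (z x) (?step x) (length (l x)))"
    by (intro computable_rec z computable_length l)
  moreover have "rec_nat (z x) (?step x) i = foldl (s x) (z x) (take i (l x))"
    if "i \<le> length (l x)" for x i
    using that by (induction i) (auto simp: take_Suc_conv_app_nth code_bit_encode)
  ultimately show ?thesis by simp
qed

lemma computable_append [computable_intros]:
  assumes "computable A f" "computable A g" shows "computable A (\<lambda>x. f x @ g x :: str)"
proof -
  have "foldl (\<lambda>r b. r @ [b]) \<sigma> \<tau> = \<sigma> @ \<tau>" for \<sigma> \<tau> :: str
    by (induction \<tau> rule: rev_induct) auto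
  moreover have "computable A (\<lambda>x. foldl (\<lambda>r b. r @ [b]) (f x) (g x))"
    by (intro computable_intros assms)
  ultimately show ?thesis by simp
qed

section \<open>Stages of a computation\<close>

text \<open>
  The big-step semantics has no notion of running time. A stage function supplies one: at stage \<open>t\<close>
  it returns \<open>Suc y\<close> if \<open>y\<close> is already known to be the value and \<open>0\<close> if no value is known yet, and it is
  total and computable. Every code has one, by recursion on the code; thus computations that may
  diverge can be run in parallel without a universal machine.
\<close>

definition stage_function :: "cantor \<Rightarrow> nat \<Rightarrow> code \<Rightarrow> (nat list \<Rightarrow> nat) \<Rightarrow> bool" where
  "stage_function A k f R \<longleftrightarrow> total_computable A (Suc k) R \<and>
    (\<forall>xs. length xs = k \<longrightarrow>
      (\<forall>y. evals A f xs y \<longleftrightarrow> (\<exists>t. R (t # xs) = Suc y)) \<and>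
      (\<forall>t y. R (t # xs) = Suc y \<longrightarrow> R (Suc t # xs) = Suc y))"

lemma stage_function_evals_iff:
  "stage_function A k f R \<Longrightarrow> length xs = k \<Longrightarrow> evals A f xs y \<longleftrightarrow> (\<exists>t. R (t # xs) = Suc y)"
  unfolding stage_function_def by blast

lemma stage_function_mono:
  assumes "stage_function A k f R" "length xs = k" "R (t # xs) = Suc y" "t \<le> t'"
  shows "R (t' # xs) = Suc y"
  using assms(4,3) by (induction rule: dec_induct) (use assms(1,2) in \<open>auto simp: stage_function_def\<close>)

lemma stage_functionI:
  assumes "total_computable A (Suc k) R"
    and "\<And>xs y. length xs = k \<Longrightarrow> evals A f xs y \<longleftrightarrow> (\<exists>t. R (t # xs) = Suc y)"
    and "\<And>xs t y. length xs = k \<Longrightarrow> R (t # xs) = Suc y \<Longrightarrow> R (Suc t # xs) = Suc y"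
  shows "stage_function A k f R"
  using assms unfolding stage_function_def by blast

lemma stage_function_diverging:
  assumes "\<And>xs y. length xs = k \<Longrightarrow> \<not> evals A f xs y"
  shows "stage_function A k f (\<lambda>_. 0)"
  using assms by (intro stage_functionI total_computable_const) auto

lemma stage_function_total:
  assumes "total_computable A k F" and "\<And>xs y. length xs = k \<Longrightarrow> evals A f xs y \<longleftrightarrow> y = F xs"
  shows "stage_function A k f (\<lambda>xs. Suc (F (tl xs)))"
  using assms
  by (intro stage_functionI total_computable_Suc total_computable_comp[OF _ total_computables_tl]) auto

inductive_cases evals_ZeroE: "evals A Zero xs y"
inductive_cases evals_SuccE: "evals A Succ xs y"
inductive_cases evals_ProjE: "evals A (Proj i) xs y"
inductive_cases evals_OracE: "evals A Orac xs y"
inductive_cases evals_CmpE: "evals A (Cmp f gs) xs y"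
inductive_cases evals_PRec_0E: "evals A (PRec f g) (0 # xs) y"
inductive_cases evals_PRec_SucE: "evals A (PRec f g) (Suc n # xs) y"
inductive_cases evals_PRec_NilE: "evals A (PRec f g) [] y"
inductive_cases evals_MuE: "evals A (Mu f) xs y"

lemma total_computable_if_zero:
  assumes F: "total_computable A k F" and G: "total_computable A k G" and H: "total_computable A k H"
  shows "total_computable A k (\<lambda>xs. if F xs = 0 then G xs else H xs)"
proof -
  have "total_computable A (Suc (Suc k)) (\<lambda>xs. H (drop 2 xs))"
    by (rule total_computable_comp[OF H total_computables_drop]) simp
  from total_computable_rec[OF G this F]
  have "total_computable A k (\<lambda>xs. rec_nat (G xs) (\<lambda>n r. H xs) (F xs))" by simp
  moreover have "rec_nat a (\<lambda>n r. b) n = (if n = 0 then a else b)" for a b n :: nat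
    by (cases n) auto
  ultimately show ?thesis by simp
qed

text \<open>
  The inner computations may become known at different stages; as there are finitely many and known
  values persist, their maximum serves for all of them.
\<close>

lemma stage_function_Cmp:
  assumes f: "stage_function A (length gs) f R"
    and gs: "\<And>g. g \<in> set gs \<Longrightarrow> stage_function A k g (Q g)"
  shows "stage_function A k (Cmp f gs)
    (\<lambda>xs. if \<forall>g\<in>set gs. Q g xs \<noteq> 0 then R (hd xs # map (\<lambda>g. Q g xs - 1) gs) else 0)"
    (is "stage_function _ _ _ ?P")
proof (rule stage_functionI)
  let ?ok = "\<lambda>xs. (\<Sum>g\<leftarrow>gs. if Q g xs = 0 then 1 else 0) = (0::nat)"
  have ok: "?ok xs \<longleftrightarrow> (\<forall>g\<in>set gs. Q g xs \<noteq> 0)" for xs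
    by (auto simp: sum_list_eq_0_iff)
  have Q: "total_computable A (Suc k) (Q g)" if "g \<in> set gs" for g
    using gs[OF that] unfolding stage_function_def by blast
  have "total_computable A (Suc k) (\<lambda>xs. \<Sum>g\<leftarrow>gs. if Q g xs = 0 then 1 else 0)"
    using Q
  proof (induction gs)
    case (Cons g gs)
    then show ?case
      by (simp add: total_computable_add total_computable_if_zero total_computable_const)
  qed (simp add: total_computable_const)
  moreover have "total_computable A (Suc k) (\<lambda>xs. R (hd xs # map (\<lambda>g. Q g xs - 1) gs))"
  proof (rule total_computable_comp)
    show "total_computable A (Suc (length gs)) R" using f unfolding stage_function_def by blast
    have "total_computables A (Suc k) (length gs) (\<lambda>xs. map (\<lambda>g. Q g xs - 1) gs)"
      by (rule total_computables_map) (rule total_computable_pred[OF Q])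
    then show "total_computables A (Suc k) (Suc (length gs)) (\<lambda>xs. hd xs # map (\<lambda>g. Q g xs - 1) gs)"
      by (rule total_computables_Cons[OF total_computable_hd])
  qed
  ultimately have "total_computable A (Suc k)
      (\<lambda>xs. if ?ok xs then R (hd xs # map (\<lambda>g. Q g xs - 1) gs) else 0)"
    by (intro total_computable_if_zero total_computable_const)
  then show "total_computable A (Suc k) ?P" by (simp only: ok)
next
  fix xs :: "nat list" and t y assume len: "length xs = k"
  let ?S = "\<lambda>t. map (\<lambda>g. Q g (t # xs) - 1) gs"
  have mono: "Q g (t' # xs) = Q g (t # xs)" if "Q g (t # xs) \<noteq> 0" "t \<le> t'" "g \<in> set gs" for g t t'
    using stage_function_mono[OF gs[OF that(3)] len _ that(2)] that(1) by (metis not0_implies_Suc)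
  show "evals A (Cmp f gs) xs y \<longleftrightarrow> (\<exists>t. ?P (t # xs) = Suc y)" (is "?L \<longleftrightarrow> ?R")
  proof
    assume ?L
    then obtain ys where ys: "list_all2 (\<lambda>g y. evals A g xs y) gs ys" "evals A f ys y" by (auto elim: evals_CmpE)
    have "\<exists>t0. \<forall>t\<ge>t0. (\<forall>g\<in>set gs. Q g (t # xs) \<noteq> 0) \<and> ?S t = ys"
      using ys(1) gs mono
    proof (induction gs ys rule: list_all2_induct)
      case (Cons g gs z ys)
      have "\<exists>t0. \<forall>t\<ge>t0. (\<forall>g\<in>set gs. Q g (t # xs) \<noteq> 0) \<and> map (\<lambda>g. Q g (t # xs) - 1) gs = ys"
      proof (rule Cons.IH)
        show "stage_function A k g (Q g)" if "g \<in> set gs" for g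
          using Cons.prems(1)[of g] that by simp
        show "Q g (t' # xs) = Q g (t # xs)" if "Q g (t # xs) \<noteq> 0" "t \<le> t'" "g \<in> set gs" for g t t'
          using Cons.prems(2)[OF that(1,2)] that(3) by simp
      qed
      then obtain t0 where
        t0: "\<forall>t\<ge>t0. (\<forall>g\<in>set gs. Q g (t # xs) \<noteq> 0) \<and> map (\<lambda>g. Q g (t # xs) - 1) gs = ys"
        by blast
      obtain t1 where t1: "Q g (t1 # xs) = Suc z"
        using Cons.hyps(1) stage_function_evals_iff[OF Cons.prems(1)[of g] len] by auto
      have "Q g (t # xs) = Suc z" if "t \<ge> t1" for t
        using Cons.prems(2)[OF _ that, of g] t1 by simp
      with t0 show ?case by (intro exI[of _ "max t0 t1"]) auto
    qed auto
    then obtain t0 where t0: "\<And>t. t \<ge> t0 \<Longrightarrow> (\<forall>g\<in>set gs. Q g (t # xs) \<noteq> 0) \<and> ?S t = ys" by blast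
    have leny: "length ys = length gs" using ys(1) by (auto dest: list_all2_lengthD)
    obtain t1 where t1: "R (t1 # ys) = Suc y"
      using ys(2) stage_function_evals_iff[OF f leny] by auto
    have "R (max t0 t1 # ys) = Suc y" by (rule stage_function_mono[OF f leny t1]) simp
    with t0[of "max t0 t1"] show ?R by (intro exI[of _ "max t0 t1"]) simp
  next
    assume ?R
    then obtain t where t: "\<forall>g\<in>set gs. Q g (t # xs) \<noteq> 0" "R (t # ?S t) = Suc y"
      by (auto split: if_splits)
    have "list_all2 (\<lambda>g y. evals A g xs y) gs (?S t)"
    proof (rule list_all2_all_nthI)
      fix i assume i: "i < length gs"
      with t(1) have "Q (gs ! i) (t # xs) = Suc (Q (gs ! i) (t # xs) - 1)" by simp
      then have "evals A (gs ! i) xs (Q (gs ! i) (t # xs) - 1)"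
        using stage_function_evals_iff[OF gs[of "gs ! i"] len] i by (metis nth_mem)
      with i show "evals A (gs ! i) xs (?S t ! i)" by simp
    qed simp
    moreover have "evals A f (?S t) y" using t(2) stage_function_evals_iff[OF f, of "?S t"] by auto
    ultimately show ?L by (rule evals.cmp)
  qed
  assume "?P (t # xs) = Suc y"
  then have t: "\<forall>g\<in>set gs. Q g (t # xs) \<noteq> 0" "R (t # ?S t) = Suc y"
    by (auto split: if_splits)
  have Q: "\<forall>g\<in>set gs. Q g (Suc t # xs) = Q g (t # xs)" using mono[of _ t "Suc t"] t(1) by simp
  then have "?S (Suc t) = ?S t" by simp
  moreover have "R (Suc t # ?S t) = Suc y" by (rule stage_function_mono[OF f _ t(2)]) auto
  ultimately show "?P (Suc t # xs) = Suc y" using t(1) Q by (simp cong: map_cong)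
qed

text \<open>
  The stage is kept fixed along the recursion, and a value that is unknown at one step makes all later
  steps unknown.
\<close>

lemma stage_function_PRec:
  assumes f: "stage_function A k f R" and g: "stage_function A (Suc (Suc k)) g Q"
  shows "stage_function A (Suc k) (PRec f g)
    (\<lambda>xs. rec_nat (R (hd xs # drop 2 xs))
      (\<lambda>n r. if r = 0 then 0 else Q (hd xs # n # (r - 1) # drop 2 xs)) (xs ! 1))"
    (is "stage_function _ _ _ ?P")
proof (rule stage_functionI)
  let ?step = "\<lambda>ys. if ys ! 1 = 0 then 0 else Q (ys ! 2 # ys ! 0 # (ys ! 1 - 1) # drop 4 ys)"
  have R: "total_computable A (Suc k) R" and Q: "total_computable A (Suc (Suc (Suc k))) Q"
    using f g unfolding stage_function_def by blast+
  have "total_computable A (Suc (Suc k)) (\<lambda>xs. R (hd xs # drop 2 xs))"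
    by (intro total_computable_comp[OF R] total_computables_Cons total_computable_hd
        total_computables_drop) simp
  moreover have "total_computable A (Suc (Suc (Suc (Suc k)))) ?step"
    by (intro total_computable_if_zero total_computable_const total_computable_comp[OF Q]
        total_computables_Cons total_computable_pred total_computable_proj total_computables_drop)
      simp_all
  ultimately have "total_computable A (Suc (Suc k))
      (\<lambda>xs. rec_nat (R (hd xs # drop 2 xs)) (\<lambda>n r. ?step (n # r # xs)) (xs ! 1))"
    by (intro total_computable_rec total_computable_proj) simp_all
  moreover have "(\<lambda>n r. ?step (n # r # xs)) = (\<lambda>n r. if r = 0 then 0 else Q (hd xs # n # (r - 1) # drop 2 xs))"
    if "length xs = Suc (Suc k)" for xs
    using that by (intro ext) (auto simp: length_Suc_conv numeral_eq_Suc)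
  ultimately show "total_computable A (Suc (Suc k)) ?P"
    by (elim total_computable_cong) simp
next
  fix ns :: "nat list" and t y assume "length ns = Suc k"
  then obtain n xs where ns: "ns = n # xs" and len: "length xs = k" by (auto simp: length_Suc_conv)
  define P where "P t n = rec_nat (R (t # xs)) (\<lambda>n r. if r = 0 then 0 else Q (t # n # (r - 1) # xs)) n"
    for t n
  have P0: "P t 0 = R (t # xs)" and PS: "P t (Suc n) = (if P t n = 0 then 0 else Q (t # n # (P t n - 1) # xs))"
    for t n by (simp_all add: P_def)
  have eq: "?P (t # ns) = P t n" for t
    unfolding P_def ns by (simp only: list.sel nth_Cons_Suc nth_Cons_0 One_nat_def drop_Suc_Cons
        numeral_2_eq_2 drop_0)
  have mono: "P t n = Suc y \<Longrightarrow> t \<le> t' \<Longrightarrow> P t' n = Suc y" for t t' n y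
  proof (induction n arbitrary: y)
    case 0 then show ?case unfolding P0 by (metis stage_function_mono[OF f len])
  next
    case (Suc n)
    then obtain z where z: "P t n = Suc z" "Q (t # n # z # xs) = Suc y"
      unfolding PS by (cases "P t n") auto
    then have "P t' n = Suc z" "Q (t' # n # z # xs) = Suc y"
      using Suc stage_function_mono[OF g _ z(2)] len by auto
    then show ?case unfolding PS by simp
  qed
  have "evals A (PRec f g) (n # xs) y \<longleftrightarrow> (\<exists>t. P t n = Suc y)" for n y
  proof (induction n arbitrary: y)
    case 0
    have "evals A (PRec f g) (0 # xs) y \<longleftrightarrow> evals A f xs y"
      by (auto elim: evals_PRec_0E intro: evals.prec_0)
    then show ?case unfolding P0 using stage_function_evals_iff[OF f len] by simp
  next
    case (Suc n)
    have "evals A (PRec f g) (Suc n # xs) y \<longleftrightarrow>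
        (\<exists>z. evals A (PRec f g) (n # xs) z \<and> evals A g (n # z # xs) y)"
      by (auto elim: evals_PRec_SucE intro: evals.prec_Suc)
    also have "\<dots> \<longleftrightarrow> (\<exists>z. (\<exists>t. P t n = Suc z) \<and> (\<exists>t. Q (t # n # z # xs) = Suc y))"
      using stage_function_evals_iff[OF g] len by (simp add: Suc)
    also have "\<dots> \<longleftrightarrow> (\<exists>z t. P t n = Suc z \<and> Q (t # n # z # xs) = Suc y)"
    proof (intro iffI; elim exE conjE)
      fix z t t' assume "P t n = Suc z" "Q (t' # n # z # xs) = Suc y"
      then have "P (max t t') n = Suc z" "Q (max t t' # n # z # xs) = Suc y"
        using mono[of t n z "max t t'"] stage_function_mono[OF g, of "n # z # xs" t' y "max t t'"] len
        by auto
      then show "\<exists>z t. P t n = Suc z \<and> Q (t # n # z # xs) = Suc y" by blast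
    qed blast
    also have "\<dots> \<longleftrightarrow> (\<exists>t. P t (Suc n) = Suc y)"
      unfolding PS by (metis Zero_not_Suc diff_Suc_1 not0_implies_Suc)
    finally show ?case .
  qed
  then show "evals A (PRec f g) ns y \<longleftrightarrow> (\<exists>t. ?P (t # ns) = Suc y)" unfolding eq unfolding ns .
  assume "?P (t # ns) = Suc y"
  then show "?P (Suc t # ns) = Suc y" unfolding eq using mono[of t n y "Suc t"] by simp
qed

text \<open>
  At stage \<open>t\<close> the search is cut off at \<open>t\<close>, and stops early at an argument whose value is not
  yet known: both are stopping conditions for the \<open>LEAST\<close>, and only a known value \<open>0\<close> below
  \<open>t\<close> counts as a success.
\<close>

lemma stage_function_Mu:
  assumes f: "stage_function A (Suc k) f R"
  shows "\<exists>P. stage_function A k (Mu f) P"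
proof -
  define stop where "stop ys = (if ys ! 1 - ys ! 0 = 0 then 0 else R (ys ! 1 # ys ! 0 # drop 2 ys) - 1)" for ys
  define s where "s xs = (LEAST n. stop (n # xs) = 0)" for xs
  define P where "P xs = (if (s xs + 1) - hd xs = 0 then
      (if R (hd xs # s xs # tl xs) = 0 then 0 else Suc (s xs)) else 0)" for xs
  have R: "total_computable A (Suc (Suc k)) R" using f unfolding stage_function_def by blast
  have "total_computable A (Suc (Suc k)) stop" unfolding stop_def
    by (intro total_computable_if_zero total_computable_const total_computable_comp[OF R]
        total_computable_diff total_computables_Cons total_computable_pred total_computable_proj
        total_computables_drop) simp_all
  then have s: "total_computable A (Suc k) s" unfolding s_def
  proof (rule total_computable_Least)
    show "\<exists>n. stop (n # xs) = 0" for xs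
      by (intro exI[of _ "xs ! 0"]) (simp add: stop_def)
  qed
  have PC: "total_computable A (Suc k) P" unfolding P_def
    by (intro total_computable_if_zero total_computable_const total_computable_comp[OF R]
        total_computable_diff total_computable_add total_computables_Cons total_computable_Suc
        total_computable_hd total_computables_tl s)
  have P_iff: "P (t # xs) = Suc n \<longleftrightarrow> n < t \<and> R (t # n # xs) = Suc 0 \<and> (\<forall>m<n. \<exists>y. R (t # m # xs) = Suc (Suc y))"
    (is "_ \<longleftrightarrow> ?C n") for t n and xs :: "nat list"
  proof -
    have stop: "stop (n # t # xs) = 0 \<longleftrightarrow> t \<le> n \<or> R (t # n # xs) = 0 \<or> R (t # n # xs) = Suc 0" for n
      by (auto simp: stop_def)
    have st: "stop (s (t # xs) # t # xs) = 0" unfolding s_def by (rule LeastI[of _ t]) (simp add: stop)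
    have below: "stop (m # t # xs) \<noteq> 0" if "m < s (t # xs)" for m
      using not_less_Least that unfolding s_def by blast
    have two: "stop (m # t # xs) \<noteq> 0 \<longleftrightarrow> m < t \<and> (\<exists>y. R (t # m # xs) = Suc (Suc y))" for m
      unfolding stop by (metis not_less old.nat.exhaust nat.distinct(1) nat.inject)
    have "P (t # xs) = Suc n \<longleftrightarrow> s (t # xs) = n \<and> n < t \<and> R (t # n # xs) \<noteq> 0"
      unfolding P_def by auto
    also have "\<dots> \<longleftrightarrow> ?C n"
    proof
      assume *: "s (t # xs) = n \<and> n < t \<and> R (t # n # xs) \<noteq> 0"
      then have "R (t # n # xs) = Suc 0" using st stop[of n] by auto
      moreover have "\<exists>y. R (t # m # xs) = Suc (Suc y)" if "m < n" for m
        using below[of m] two[of m] * that by blast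
      ultimately show "?C n" using * by blast
    next
      assume *: "?C n"
      have "s (t # xs) = n" unfolding s_def
      proof (rule Least_equality)
        show "stop (n # t # xs) = 0" using * by (simp add: stop)
        fix m assume "stop (m # t # xs) = 0"
        then show "n \<le> m" using * two[of m] by (meson less_trans not_less)
      qed
      with * show "s (t # xs) = n \<and> n < t \<and> R (t # n # xs) \<noteq> 0" by simp
    qed
    finally show ?thesis .
  qed
  have "stage_function A k (Mu f) P"
  proof (rule stage_functionI[OF PC])
    fix xs :: "nat list" and t n assume len: "length xs = k"
    have Rm: "R (t # n # xs) = Suc y \<Longrightarrow> t \<le> t' \<Longrightarrow> R (t' # n # xs) = Suc y" for t t' n y
      using stage_function_mono[OF f, of "n # xs" t y t'] len by simp
    have ev: "evals A f (n # xs) y \<longleftrightarrow> (\<exists>t. R (t # n # xs) = Suc y)" for n y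
      using stage_function_evals_iff[OF f, of "n # xs" y] len by simp
    show "P (t # xs) = Suc n \<Longrightarrow> P (Suc t # xs) = Suc n"
      unfolding P_iff using Rm[of t _ _ "Suc t"] by (metis le_Suc_eq less_SucI order_refl)
    have "evals A (Mu f) xs n \<longleftrightarrow> evals A f (n # xs) 0 \<and> (\<forall>m<n. \<exists>y. evals A f (m # xs) (Suc y))"
      by (auto elim: evals_MuE intro: evals.mu)
    also have "\<dots> \<longleftrightarrow> (\<exists>t. n < t \<and> R (t # n # xs) = Suc 0 \<and> (\<forall>m<n. \<exists>y. R (t # m # xs) = Suc (Suc y)))"
    proof
      assume *: "evals A f (n # xs) 0 \<and> (\<forall>m<n. \<exists>y. evals A f (m # xs) (Suc y))"
      then obtain t0 where t0: "R (t0 # n # xs) = Suc 0" using ev by auto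
      have "\<exists>t1. \<forall>m<j. \<exists>y. R (t1 # m # xs) = Suc (Suc y)" if "j \<le> n" for j using that
      proof (induction j)
        case (Suc j)
        then obtain t1 where t1: "\<forall>m<j. \<exists>y. R (t1 # m # xs) = Suc (Suc y)" by auto
        obtain t2 y where t2: "R (t2 # j # xs) = Suc (Suc y)"
          using * Suc.prems unfolding ev by (meson Suc_le_lessD)
        show ?case
        proof (rule exI[of _ "max t1 t2"], intro allI impI)
          fix m assume "m < Suc j"
          then show "\<exists>y. R (max t1 t2 # m # xs) = Suc (Suc y)"
            using t1 t2 Rm[of _ m _ "max t1 t2"] by (metis less_Suc_eq max.cobounded1 max.cobounded2)
        qed
      qed simp
      from this[OF order_refl]
      obtain t1 where t1: "\<forall>m<n. \<exists>y. R (t1 # m # xs) = Suc (Suc y)" by blast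
      let ?t = "max (Suc n) (max t0 t1)"
      have "R (?t # n # xs) = Suc 0" using Rm[OF t0, of ?t] by simp
      moreover have "\<exists>y. R (?t # m # xs) = Suc (Suc y)" if "m < n" for m
        using t1 that Rm[of t1 m _ ?t] by (metis max.cobounded2 max.coboundedI2)
      ultimately show "\<exists>t. n < t \<and> R (t # n # xs) = Suc 0 \<and> (\<forall>m<n. \<exists>y. R (t # m # xs) = Suc (Suc y))"
        by (intro exI[of _ ?t]) auto
    next
      assume "\<exists>t. n < t \<and> R (t # n # xs) = Suc 0 \<and> (\<forall>m<n. \<exists>y. R (t # m # xs) = Suc (Suc y))"
      then show "evals A f (n # xs) 0 \<and> (\<forall>m<n. \<exists>y. evals A f (m # xs) (Suc y))"
        unfolding ev by blast
    qed
    finally show "evals A (Mu f) xs n \<longleftrightarrow> (\<exists>t. P (t # xs) = Suc n)" unfolding P_iff .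
  qed
  then show ?thesis by blast
qed

lemma stage_function_exists: "\<exists>R. stage_function A k f R"
proof (induction f arbitrary: k)
  case Zero
  have "stage_function A k Zero (\<lambda>xs. Suc 0)"
    by (rule stage_function_total[OF total_computable_const]) (auto elim: evals_ZeroE intro: evals.zero)
  then show ?case by blast
next
  case Succ
  show ?case
  proof (cases k)
    case 0 then show ?thesis using stage_function_diverging[of k A Succ] by (auto elim: evals_SuccE)
  next
    case (Suc j)
    have "stage_function A k Succ (\<lambda>xs. Suc (Suc (hd (tl xs))))" unfolding Suc
      by (rule stage_function_total[OF total_computable_Suc[OF total_computable_hd]])
        (auto simp: length_Suc_conv elim: evals_SuccE intro: evals.succ)
    then show ?thesis by blast
  qed
next
  case (Proj i)
  show ?case
  proof (cases "i < k")
    case True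
    have "stage_function A k (Proj i) (\<lambda>xs. Suc (tl xs ! i))"
      by (rule stage_function_total[OF total_computable_proj[OF True]])
        (use True in \<open>auto elim: evals_ProjE intro: evals.proj\<close>)
    then show ?thesis by blast
  next
    case False then show ?thesis using stage_function_diverging[of k A "Proj i"] by (auto elim: evals_ProjE)
  qed
next
  case Orac
  show ?case
  proof (cases k)
    case 0 then show ?thesis using stage_function_diverging[of k A Orac] by (auto elim: evals_OracE)
  next
    case (Suc j)
    have "evals A Orac xs y \<longleftrightarrow> y = (if A (hd xs) then 1 else 0)" if "length xs = Suc j" for xs y
    proof -
      obtain a zs where "xs = a # zs" using \<open>length xs = Suc j\<close> by (cases xs) auto
      then show ?thesis using evals.orac[of A a zs]
        by (auto elim: evals_OracE split: if_splits)
    qed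
    then have "stage_function A k Orac (\<lambda>xs. Suc (if A (hd (tl xs)) then 1 else 0))" unfolding Suc
      by (intro stage_function_total[OF total_computable_oracle[OF total_computable_hd]])
    then show ?thesis by blast
  qed
next
  case (Cmp f gs)
  obtain R where R: "stage_function A (length gs) f R" using Cmp.IH(1) by blast
  obtain Q where Q: "\<And>g. g \<in> set gs \<Longrightarrow> stage_function A k g (Q g)" 
    using bchoice[of "set gs" "stage_function A k"] Cmp.IH(2) by blast
  show ?case using stage_function_Cmp[OF R Q] by blast
next
  case (PRec f g)
  show ?case
  proof (cases k)
    case 0
    have "\<not> evals A (PRec f g) xs y" if "length xs = k" for xs y
      using that 0 by (auto elim: evals_PRec_NilE)
    from stage_function_diverging[OF this] show ?thesis by blast
  next
    case (Suc j) then show ?thesis using PRec stage_function_PRec by blast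
  qed
next
  case (Mu f)
  then show ?case using stage_function_Mu by blast
qed

text \<open>
  Two values of one computation are both known at the later of two stages, where the stage function
  has a single value.
\<close>

lemma evals_deterministic:
  assumes "evals A f xs y" "evals A f xs z" shows "y = z"
proof -
  obtain R where R: "stage_function A (length xs) f R" using stage_function_exists by blast
  obtain s t where s: "R (s # xs) = Suc y" and t: "R (t # xs) = Suc z"
    using assms stage_function_evals_iff[OF R refl] by blast
  have "R (max s t # xs) = Suc y" by (rule stage_function_mono[OF R refl s]) simp
  moreover have "R (max s t # xs) = Suc z" by (rule stage_function_mono[OF R refl t]) simp
  ultimately show ?thesis by simp
qed

text \<open>
  Substituting total functions pulls back domains: the values passed on are the only possible ones.
\<close>

lemma halts_Cmp_iff:
  assumes "list_all2 (\<lambda>g y. evals A g xs y) gs ys"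
  shows "(\<exists>z. evals A (Cmp f gs) xs z) \<longleftrightarrow> (\<exists>z. evals A f ys z)"
proof
  assume "\<exists>z. evals A (Cmp f gs) xs z"
  then obtain ys' z where *: "list_all2 (\<lambda>g y. evals A g xs y) gs ys'" "evals A f ys' z"
    by (auto elim: evals_CmpE)
  have "ys' = ys"
  proof (rule nth_equalityI)
    show len: "length ys' = length ys" using assms *(1) by (metis list_all2_lengthD)
    show "ys' ! i = ys ! i" if "i < length ys'" for i
      using list_all2_nthD2[OF *(1) that] list_all2_nthD2[OF assms that[unfolded len]]
      by (rule evals_deterministic)
  qed
  with * show "\<exists>z. evals A f ys z" by blast
qed (use assms in \<open>blast intro: evals.cmp\<close>)

section \<open>Semidecidable predicates\<close>

text \<open>
  Domains of partial computable functions, for arguments of any coded type; a uniformly c.e. sequence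
  of sets is one such domain, of pairs.
\<close>

definition semidecidable :: "('a::coded \<Rightarrow> bool) \<Rightarrow> bool" where
  "semidecidable P \<longleftrightarrow> (\<exists>f. \<forall>x. P x \<longleftrightarrow> (\<exists>y. evals (\<lambda>_. False) f [encode x] y))"

lemma ce_iff_semidecidable: "ce S \<longleftrightarrow> semidecidable (\<lambda>\<sigma>. \<sigma> \<in> S)"
  unfolding ce_def semidecidable_def encode_str ..

lemma semidecidable_comp:
  assumes "semidecidable P" "computable (\<lambda>_. False) g" shows "semidecidable (\<lambda>x. P (g x))"
proof -
  obtain f where f: "\<And>x. P x \<longleftrightarrow> (\<exists>y. evals (\<lambda>_. False) f [encode x] y)"
    using assms(1) unfolding semidecidable_def by blast
  obtain c where c: "\<And>x. evals (\<lambda>_. False) c [encode x] (encode (g x))"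
    using assms(2) unfolding computable_def by blast
  have "(\<exists>y. evals (\<lambda>_. False) f [encode (g x)] y) \<longleftrightarrow>
      (\<exists>y. evals (\<lambda>_. False) (Cmp f [c]) [encode x] y)" for x
    using c[of x] by (intro halts_Cmp_iff[symmetric]) simp
  then show ?thesis using f unfolding semidecidable_def by blast
qed

lemma uniformly_ce_iff_semidecidable:
  "uniformly_ce S \<longleftrightarrow> semidecidable (\<lambda>(n, \<sigma>). \<sigma> \<in> S n)"
proof
  assume "uniformly_ce S"
  then obtain f where f: "\<And>n \<sigma>. \<sigma> \<in> S n \<longleftrightarrow> (\<exists>y. evals (\<lambda>_. False) f [n, encode \<sigma>] y)"
    unfolding uniformly_ce_def encode_str by blast
  have "computable (\<lambda>_. False) (fst :: nat \<times> str \<Rightarrow> nat)" "computable (\<lambda>_. False) (snd :: nat \<times> str \<Rightarrow> str)"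
    by (intro computable_intros)+
  then obtain c e where
    c: "\<And>p :: nat \<times> str. evals (\<lambda>_. False) c [encode p] (encode (fst p))" and
    e: "\<And>p :: nat \<times> str. evals (\<lambda>_. False) e [encode p] (encode (snd p))"
    unfolding computable_def by blast
  have "(\<exists>y. evals (\<lambda>_. False) f [n, encode \<sigma>] y) \<longleftrightarrow>
      (\<exists>y. evals (\<lambda>_. False) (Cmp f [c, e]) [encode (n, \<sigma>)] y)" for n and \<sigma> :: str
    using c[of "(n, \<sigma>)"] e[of "(n, \<sigma>)"] by (intro halts_Cmp_iff[symmetric]) simp
  then show "semidecidable (\<lambda>(n, \<sigma>). \<sigma> \<in> S n)"
    unfolding semidecidable_def using f by (intro exI[of _ "Cmp f [c, e]"]) auto
next
  assume "semidecidable (\<lambda>(n, \<sigma>). \<sigma> \<in> S n)"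
  then obtain f where f: "\<And>n \<sigma>. \<sigma> \<in> S n \<longleftrightarrow> (\<exists>y. evals (\<lambda>_. False) f [encode (n, \<sigma>)] y)"
    unfolding semidecidable_def by fast
  have "total_computable (\<lambda>_. False) 2 (\<lambda>xs. prod_encode (xs ! 0, xs ! 1))"
    by (intro total_computable_prod_encode total_computable_proj) auto
  then obtain p where "\<And>xs. length xs = 2 \<Longrightarrow>
      evals (\<lambda>_. False) p xs (prod_encode (xs ! 0, xs ! 1))"
    unfolding total_computable_def by blast
  from this[of "[_, _]"]
  have p: "evals (\<lambda>_. False) p [n, encode \<sigma>] (encode (n, \<sigma>))" for n and \<sigma> :: str
    by (simp add: encode_prod_def)
  have "(\<exists>y. evals (\<lambda>_. False) f [encode (n, \<sigma>)] y) \<longleftrightarrow>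
      (\<exists>y. evals (\<lambda>_. False) (Cmp f [p]) [n, encode \<sigma>] y)" for n and \<sigma> :: str
    using p[of n \<sigma>] by (intro halts_Cmp_iff[symmetric]) simp
  then show "uniformly_ce S"
    unfolding uniformly_ce_def encode_str[symmetric] using f by (intro exI[of _ "Cmp f [p]"]) auto
qed

text \<open>
  Together with \<open>semidecidable_ex\<close> this identifies the semidecidable predicates with the projections
  of decidable ones, which is how new semidecidable predicates are obtained from old ones.
\<close>

lemma semidecidable_stages:
  fixes P :: "'a::coded \<Rightarrow> bool"
  assumes "semidecidable P"
  obtains Q :: "nat \<Rightarrow> 'a \<Rightarrow> bool" where "computable (\<lambda>_. False) (\<lambda>p. Q (fst p) (snd p))"
    and "\<And>x. P x \<longleftrightarrow> (\<exists>t. Q t x)" and "\<And>s t x. Q s x \<Longrightarrow> s \<le> t \<Longrightarrow> Q t x"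
proof -
  obtain f where f: "\<And>x. P x \<longleftrightarrow> (\<exists>y. evals (\<lambda>_. False) f [encode x] y)"
    using assms unfolding semidecidable_def by blast
  obtain R where R: "stage_function (\<lambda>_. False) 1 f R" using stage_function_exists by blast
  have "total_computable (\<lambda>_. False) 2 R" using R unfolding stage_function_def by (simp add: numeral_2_eq_2)
  then obtain c where "\<And>xs. length xs = 2 \<Longrightarrow> evals (\<lambda>_. False) c xs (R xs)"
    unfolding total_computable_def by blast
  from this[of "[_, _]"] have c: "evals (\<lambda>_. False) c [t, n] (R [t, n])" for t n by simp
  have "computable (\<lambda>_. False) (fst :: nat \<times> 'a \<Rightarrow> nat)" "computable (\<lambda>_. False) (snd :: nat \<times> 'a \<Rightarrow> 'a)"
    by (intro computable_intros)+
  then obtain d e where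
    d: "\<And>p :: nat \<times> 'a. evals (\<lambda>_. False) d [encode p] (encode (fst p))" and
    e: "\<And>p :: nat \<times> 'a. evals (\<lambda>_. False) e [encode p] (encode (snd p))"
    unfolding computable_def by blast
  have "evals (\<lambda>_. False) (Cmp c [d, e]) [encode p] (R [fst p, encode (snd p)])" for p :: "nat \<times> 'a"
    using c d[of p] e[of p] by (intro evals.cmp[where ys = "[fst p, encode (snd p)]"]) auto
  then have "computable (\<lambda>_. False) (\<lambda>p :: nat \<times> 'a. R [fst p, encode (snd p)])"
    unfolding computable_def encode_nat_def by blast
  then have "computable (\<lambda>_. False) (\<lambda>p :: nat \<times> 'a. \<not> R [fst p, encode (snd p)] = 0)"
    by (intro computable_intros)
  moreover have "P x \<longleftrightarrow> (\<exists>t. R [t, encode x] \<noteq> 0)" for x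
  proof -
    have "(\<exists>y. n = Suc y) \<longleftrightarrow> n \<noteq> 0" for n by (cases n) auto
    moreover have "P x \<longleftrightarrow> (\<exists>t y. R [t, encode x] = Suc y)"
      unfolding f using stage_function_evals_iff[OF R, of "[encode x]"] by auto blast
    ultimately show ?thesis by simp
  qed
  moreover have "R [t, encode x] \<noteq> 0" if "R [s, encode x] \<noteq> 0" "s \<le> t" for s t and x :: 'a
    using stage_function_mono[OF R, of "[encode x]" s _ t] that
    by (metis One_nat_def length_Cons list.size(3) not0_implies_Suc Zero_not_Suc)
  ultimately show ?thesis using that[of "\<lambda>t x. R [t, encode x] \<noteq> 0"] by blast
qed

lemma semidecidable_ex:
  fixes Q :: "nat \<Rightarrow> 'a::coded \<Rightarrow> bool"
  assumes "computable (\<lambda>_. False) (\<lambda>p. Q (fst p) (snd p))"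
  shows "semidecidable (\<lambda>x. \<exists>t. Q t x)"
proof -
  have "computable (\<lambda>_. False) (\<lambda>p. \<not> Q (fst p) (snd p))" by (intro computable_not assms)
  then obtain c where "\<And>p. evals (\<lambda>_. False) c [encode p] (encode (\<not> Q (fst p) (snd p)))"
    unfolding computable_def by blast
  then have c: "evals (\<lambda>_. False) c [encode (t, x)] (encode (\<not> Q t x))" for t x
    by (metis fst_conv snd_conv)
  have "total_computable (\<lambda>_. False) 2 (\<lambda>xs. prod_encode (xs ! 0, xs ! 1))"
    by (intro total_computable_prod_encode total_computable_proj) auto
  then obtain p where "\<And>xs. length xs = 2 \<Longrightarrow>
      evals (\<lambda>_. False) p xs (prod_encode (xs ! 0, xs ! 1))"
    unfolding total_computable_def by blast
  from this[of "[_, _]"]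
  have p: "evals (\<lambda>_. False) p [t, encode x] (encode (t, x))" for t and x :: 'a
    by (simp add: encode_prod_def)
  have q: "evals (\<lambda>_. False) (Cmp c [p]) [t, encode x] (encode (\<not> Q t x))" for t x
    using p[of t x] c by (intro evals.cmp[where ys = "[encode (t, x)]"]) auto
  have "(\<exists>t. Q t x) \<longleftrightarrow> (\<exists>y. evals (\<lambda>_. False) (Mu (Cmp c [p])) [encode x] y)" for x
  proof
    assume ex: "\<exists>t. Q t x"
    have "evals (\<lambda>_. False) (Mu (Cmp c [p])) [encode x] (LEAST t. Q t x)"
    proof (rule evals.mu)
      show "evals (\<lambda>_. False) (Cmp c [p]) [LEAST t. Q t x, encode x] 0"
        using q[of "LEAST t. Q t x" x] LeastI_ex[OF ex] by simp
      show "\<forall>m<LEAST t. Q t x. \<exists>y. evals (\<lambda>_. False) (Cmp c [p]) [m, encode x] (Suc y)"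
        using q[of _ x] not_less_Least[of _ "\<lambda>t. Q t x"]
        by (metis encode_bool_def of_bool_eq(2) One_nat_def)
    qed
    then show "\<exists>y. evals (\<lambda>_. False) (Mu (Cmp c [p])) [encode x] y" by blast
  next
    assume "\<exists>y. evals (\<lambda>_. False) (Mu (Cmp c [p])) [encode x] y"
    then obtain t where "evals (\<lambda>_. False) (Cmp c [p]) [t, encode x] 0" by (auto elim: evals_MuE)
    from evals_deterministic[OF q this] have "Q t x" by (cases "Q t x") auto
    then show "\<exists>t. Q t x" by blast
  qed
  then show ?thesis unfolding semidecidable_def by blast
qed

section \<open>Nonnegative rational values\<close>

text \<open>
  The fold also carries the prefix read so far, since the step may depend on it.
\<close>

lemma computable_snoc_rec:
  fixes h :: "'a::coded \<Rightarrow> str \<Rightarrow> 'b::coded"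
  assumes z: "computable A (\<lambda>x. h x [])"
    and s: "computable A (\<lambda>p. s (fst p) (fst (snd p)) (fst (snd (snd p))) (snd (snd (snd p))))"
    and step: "\<And>x \<sigma> b. h x (\<sigma> @ [b]) = s x \<sigma> b (h x \<sigma>)"
  shows "computable A (\<lambda>p. h (fst p) (snd p))"
proof -
  let ?s = "\<lambda>p st b. (fst st @ [b], s (fst p) (fst st) b (snd st))"
  have "computable A (\<lambda>q :: ('a \<times> str) \<times> (str \<times> 'b) \<times> bool.
      s (fst (fst q)) (fst (fst (snd q))) (snd (snd q)) (snd (fst (snd q))))"
  proof -
    have "computable A (\<lambda>q :: ('a \<times> str) \<times> (str \<times> 'b) \<times> bool.
        (fst (fst q), fst (fst (snd q)), snd (snd q), snd (fst (snd q))))"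
      by (intro computable_intros)
    from computable_comp[OF s this] show ?thesis by simp
  qed
  then have "computable A (\<lambda>p. snd (foldl (?s p) ([], h (fst p) []) (snd p)))"
    by (intro computable_intros computable_comp[OF z])
  moreover have "foldl (?s p) ([], h (fst p) []) \<sigma> = (\<sigma>, h (fst p) \<sigma>)" for p :: "'a \<times> str" and \<sigma>
    by (induction \<sigma> rule: rev_induct) (auto simp: step)
  ultimately show ?thesis by simp
qed

text \<open>
  An index of the enumeration of the rationals codes two integers \<open>p\<close> and \<open>q\<close>, with even codes for the
  nonnegative and odd codes for the negative ones. The quotient can be positive only if both codes have
  the same parity and the second is not the code \<open>0\<close> of zero; all other quotients are mapped to \<open>0 / 1\<close>.
\<close>

definition rat_numerator :: "nat \<Rightarrow> nat" where
  "rat_numerator y = (let p = fst (prod_decode y); q = snd (prod_decode y) in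
    if even (p + q) \<and> q \<noteq> 0 then (if even p then p div 2 else Suc (p div 2)) else 0)"

definition rat_denominator :: "nat \<Rightarrow> nat" where
  "rat_denominator y = (let p = fst (prod_decode y); q = snd (prod_decode y) in
    if even (p + q) \<and> q \<noteq> 0 then (if even q then q div 2 else Suc (q div 2)) else 1)"

lemma rat_denominator_pos: "0 < rat_denominator y"
  by (auto simp: rat_denominator_def Let_def elim!: evenE)

lemma int_decode_eq_if: "int_decode n = (if even n then int (n div 2) else - int (Suc (n div 2)))"
  by (simp add: int_decode_def sum_decode_def)

lemma max_0_rat:
  "max 0 (of_rat (nat_to_rat_surj y)) = real (rat_numerator y) / real (rat_denominator y)"
proof -
  obtain p q where pq: "prod_decode y = (p, q)" by (cases "prod_decode y")
  have r: "of_rat (nat_to_rat_surj y) = real_of_int (int_decode p) / real_of_int (int_decode q)"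
    by (cases "int_decode q = 0") (simp_all add: nat_to_rat_surj_def pq of_rat_rat eq_rat(2) flip: Zero_rat_def)
  show ?thesis
  proof (cases "even (p + q) \<and> q \<noteq> 0")
    case True
    then show ?thesis unfolding r
      by (cases "even p") (auto simp: int_decode_eq_if rat_numerator_def rat_denominator_def pq
          max_def divide_simps algebra_simps)
  next
    case False
    then have "real_of_int (int_decode p) / real_of_int (int_decode q) \<le> 0"
      by (auto simp: int_decode_eq_if divide_le_0_iff)
    with False show ?thesis unfolding r by (auto simp: rat_numerator_def rat_denominator_def pq)
  qed
qed

lemma computable_prod_decode [computable_intros]:
  assumes "computable A f" shows "computable A (\<lambda>x. prod_decode (f x))"
proof -
  have "encode (prod_decode n) = n" for n by (simp add: encode_prod_def)
  then have "computable A (\<lambda>x. encode (prod_decode (f x)))" using assms by simp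
  then show ?thesis by (simp only: computable_encode_iff)
qed

lemma computable_rat_numerator: "computable A rat_numerator"
  and computable_rat_denominator: "computable A rat_denominator"
  unfolding rat_numerator_def[abs_def] rat_denominator_def[abs_def] Let_def
  by (intro computable_intros)+

text \<open>
  Martingales take no negative values, so their exact computation can avoid signs altogether: a
  nonnegative rational is a quotient of two natural numbers.
\<close>

definition computable_fraction :: "cantor \<Rightarrow> ('a::coded \<Rightarrow> real) \<Rightarrow> bool" where
  "computable_fraction A d \<longleftrightarrow> (\<exists>a c. computable A a \<and> computable A c \<and>
    (\<forall>x. 0 < c x \<and> d x = real (a x) / real (c x)))"

lemma computable_fractionI:
  assumes "computable A a" "computable A c" "\<And>x. 0 < c x" "\<And>x. d x = real (a x) / real (c x)"
  shows "computable_fraction A d"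
  using assms unfolding computable_fraction_def by blast

lemma computable_fractionE:
  assumes "computable_fraction A d"
  obtains a c where "computable A a" "computable A c" "\<And>x. 0 < c x" "\<And>x. d x = real (a x) / real (c x)"
  using assms unfolding computable_fraction_def by blast

lemma computable_fraction_comp:
  assumes "computable_fraction A d" "computable A f" shows "computable_fraction A (\<lambda>x. d (f x))"
proof -
  obtain a c where *: "computable A a" "computable A c" "\<And>x. 0 < c x" "\<And>x. d x = real (a x) / real (c x)"
    using assms(1) by (rule computable_fractionE) blast
  show ?thesis
    by (rule computable_fractionI[OF computable_comp[OF *(1) assms(2)] computable_comp[OF *(2) assms(2)]
          *(3) *(4)])
qed

lemma computable_fraction_const:
  assumes "0 \<le> r" "r \<in> \<rat>" shows "computable_fraction A (\<lambda>x. r)"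
proof -
  obtain y where "r = of_rat (nat_to_rat_surj y)"
    using surj_of_rat_nat_to_rat_surj[OF assms(2)] by blast
  with max_0_rat[of y] assms(1) have "r = real (rat_numerator y) / real (rat_denominator y)" by simp
  then show ?thesis
    by (rule computable_fractionI[OF computable_const[of A "rat_numerator y"]
          computable_const[of A "rat_denominator y"] rat_denominator_pos])
qed

lemma computable_fraction_add:
  assumes "computable_fraction A d" "computable_fraction A e"
  shows "computable_fraction A (\<lambda>x. d x + e x)"
proof -
  obtain a c where 1: "computable A a" "computable A c" "\<And>x. 0 < c x" "\<And>x. d x = real (a x) / real (c x)"
    using assms(1) by (rule computable_fractionE) blast
  obtain b f where 2: "computable A b" "computable A f" "\<And>x. 0 < f x" "\<And>x. e x = real (b x) / real (f x)"
    using assms(2) by (rule computable_fractionE) blast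
  show ?thesis
  proof (rule computable_fractionI)
    show "computable A (\<lambda>x. a x * f x + b x * c x)" "computable A (\<lambda>x. c x * f x)"
      by (intro computable_intros 1 2)+
    show "0 < c x * f x" for x using 1(3) 2(3) by simp
    show "d x + e x = real (a x * f x + b x * c x) / real (c x * f x)" for x
      using 1(3)[of x] 2(3)[of x] unfolding 1(4) 2(4) by (simp add: add_frac_eq)
  qed
qed

lemma computable_fraction_mult:
  assumes "computable_fraction A d" "computable_fraction A e"
  shows "computable_fraction A (\<lambda>x. d x * e x)"
proof -
  obtain a c where 1: "computable A a" "computable A c" "\<And>x. 0 < c x" "\<And>x. d x = real (a x) / real (c x)"
    using assms(1) by (rule computable_fractionE) blast
  obtain b f where 2: "computable A b" "computable A f" "\<And>x. 0 < f x" "\<And>x. e x = real (b x) / real (f x)"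
    using assms(2) by (rule computable_fractionE) blast
  show ?thesis
  proof (rule computable_fractionI)
    show "computable A (\<lambda>x. a x * b x)" "computable A (\<lambda>x. c x * f x)"
      by (intro computable_intros 1 2)+
    show "0 < c x * f x" for x using 1(3) 2(3) by simp
    show "d x * e x = real (a x * b x) / real (c x * f x)" for x
      unfolding 1(4) 2(4) by simp
  qed
qed

lemma computable_fraction_le:
  assumes "computable_fraction A d" "computable_fraction A e"
  shows "computable A (\<lambda>x. d x \<le> e x)"
proof -
  obtain a c where 1: "computable A a" "computable A c" "\<And>x. 0 < c x" "\<And>x. d x = real (a x) / real (c x)"
    using assms(1) by (rule computable_fractionE) blast
  obtain b f where 2: "computable A b" "computable A f" "\<And>x. 0 < f x" "\<And>x. e x = real (b x) / real (f x)"
    using assms(2) by (rule computable_fractionE) blast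
  have "d x \<le> e x \<longleftrightarrow> a x * f x \<le> b x * c x" for x
    using 1(3)[of x] 2(3)[of x] unfolding 1(4) 2(4)
    by (simp add: divide_le_eq le_divide_eq flip: of_nat_mult)
  then show ?thesis by (simp, intro computable_intros 1 2)
qed

lemma computable_fraction_If:
  assumes b: "computable A b" and "computable_fraction A d" "computable_fraction A e"
  shows "computable_fraction A (\<lambda>x. if b x then d x else e x)"
proof -
  obtain a c where 1: "computable A a" "computable A c" "\<And>x. 0 < c x" "\<And>x. d x = real (a x) / real (c x)"
    using assms(2) by (rule computable_fractionE) blast
  obtain u v where 2: "computable A u" "computable A v" "\<And>x. 0 < v x" "\<And>x. e x = real (u x) / real (v x)"
    using assms(3) by (rule computable_fractionE) blast
  show ?thesis
  proof (rule computable_fractionI)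
    show "computable A (\<lambda>x. if b x then a x else u x)" "computable A (\<lambda>x. if b x then c x else v x)"
      by (intro computable_If b 1 2)+
  qed (auto simp: 1 2)
qed

text \<open>
  Recursion along a string with an affine step. The difference of the last two terms may be
  negative; as the values are nonnegative, truncated subtraction computes the numerators.
\<close>

lemma computable_fraction_snoc_rec:
  fixes g :: "str \<Rightarrow> real"
  assumes z: "g [] \<in> \<rat>" and nonneg: "\<And>\<sigma>. 0 \<le> g \<sigma>"
    and m: "computable_fraction A (\<lambda>p. m (fst p) (snd p))"
    and u: "computable_fraction A (\<lambda>p. u (fst p) (snd p))"
    and v: "computable_fraction A (\<lambda>p. v (fst p) (snd p))"
    and step: "\<And>\<sigma> b. g (\<sigma> @ [b]) = g \<sigma> * m \<sigma> b + u \<sigma> b - v \<sigma> b"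
  shows "computable_fraction A g"
proof -
  obtain a c where 1: "computable A a" "computable A c" "\<And>p. 0 < c p"
      "\<And>p. m (fst p) (snd p) = real (a p) / real (c p)"
    using m by (rule computable_fractionE) blast
  obtain a' c' where 2: "computable A a'" "computable A c'" "\<And>p. 0 < c' p"
      "\<And>p. u (fst p) (snd p) = real (a' p) / real (c' p)"
    using u by (rule computable_fractionE) blast
  obtain a'' c'' where 3: "computable A a''" "computable A c''" "\<And>p. 0 < c'' p"
      "\<And>p. v (fst p) (snd p) = real (a'' p) / real (c'' p)"
    using v by (rule computable_fractionE) blast
  obtain n0 d0 where 0: "0 < d0" "g [] = real n0 / real d0"
    using computable_fraction_const[OF nonneg z, of A] unfolding computable_fraction_def by metis
  define s where "s st b = (let p = (fst st, b); n = fst (snd st); d = snd (snd st) in (fst st @ [b],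
      n * a p * c' p * c'' p + a' p * d * c p * c'' p - a'' p * d * c p * c' p, d * c p * c' p * c'' p))"
    for st :: "str \<times> nat \<times> nat" and b
  define F where "F \<sigma> = foldl s ([], n0, d0) \<sigma>" for \<sigma>
  have F0: "F [] = ([], n0, d0)" and FS: "F (\<sigma> @ [b]) = s (F \<sigma>) b" for \<sigma> b by (simp_all add: F_def)
  have sC: "computable A (\<lambda>p. s (fst p) (snd p))"
    unfolding s_def Let_def
    by (intro computable_intros 1(1,2)[THEN computable_comp] 2(1,2)[THEN computable_comp]
        3(1,2)[THEN computable_comp])
  have "computable A (\<lambda>p :: str \<times> (str \<times> nat \<times> nat) \<times> bool. s (fst (snd p)) (snd (snd p)))"
    using computable_comp[OF sC, of snd] by (simp add: computable_snd computable_id)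
  then have "computable A F" unfolding F_def by (rule computable_foldl[OF _ computable_const computable_id])
  moreover have "fst (F \<sigma>) = \<sigma> \<and> 0 < snd (snd (F \<sigma>)) \<and>
      g \<sigma> = real (fst (snd (F \<sigma>))) / real (snd (snd (F \<sigma>)))" for \<sigma>
  proof (induction \<sigma> rule: rev_induct)
    case Nil then show ?case by (simp add: F0 0)
  next
    case (snoc b \<sigma>)
    obtain n d where nd: "F \<sigma> = (\<sigma>, n, d)" "0 < d" "g \<sigma> = real n / real d"
      using snoc.IH by (cases "F \<sigma>") auto
    let ?p = "(\<sigma>, b)"
    let ?pos = "n * a ?p * c' ?p * c'' ?p + a' ?p * d * c ?p * c'' ?p"
    let ?neg = "a'' ?p * d * c ?p * c' ?p"
    let ?den = "d * c ?p * c' ?p * c'' ?p"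
    have pos: "0 < c ?p" "0 < c' ?p" "0 < c'' ?p" using 1(3) 2(3) 3(3) by auto
    then have den: "0 < ?den" using nd(2) by simp
    have "g (\<sigma> @ [b]) = real n / real d * (real (a ?p) / real (c ?p)) + real (a' ?p) / real (c' ?p)
        - real (a'' ?p) / real (c'' ?p)"
      using 1(4)[of ?p] 2(4)[of ?p] 3(4)[of ?p] by (simp add: step nd(3))
    also have "\<dots> = (real ?pos - real ?neg) / real ?den"
      using nd(2) pos by (simp add: field_simps)
    finally have eq: "g (\<sigma> @ [b]) = (real ?pos - real ?neg) / real ?den" .
    have "0 < real ?den" using den by (simp only: of_nat_0_less_iff)
    moreover have "0 \<le> (real ?pos - real ?neg) / real ?den"
      using nonneg[of "\<sigma> @ [b]"] by (simp only: eq)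
    ultimately have "0 \<le> real ?pos - real ?neg" by (meson divide_neg_pos not_le)
    then have "real ?neg \<le> real ?pos" by (simp only: diff_ge_0_iff_ge)
    then have "?neg \<le> ?pos" by (simp only: of_nat_le_iff)
    with eq have "g (\<sigma> @ [b]) = real (?pos - ?neg) / real ?den" by (simp only: of_nat_diff)
    then show ?case using den by (simp add: FS s_def nd(1) Let_def)
  qed
  ultimately show ?thesis
    by (intro computable_fractionI[of A "\<lambda>\<sigma>. fst (snd (F \<sigma>))" "\<lambda>\<sigma>. snd (snd (F \<sigma>))"] computable_intros) auto
qed

lemma exactly_computable_iff_fraction:
  assumes nonneg: "\<And>\<sigma>. 0 \<le> d \<sigma>"
  shows "exactly_computable A d \<longleftrightarrow> computable_fraction A d"
proof
  assume "exactly_computable A d"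
  then obtain f where "\<And>\<sigma>. \<exists>y. evals A f [encode \<sigma>] y \<and> d \<sigma> = of_rat (nat_to_rat_surj y)"
    unfolding exactly_computable_def encode_str by blast
  then obtain y where y: "\<And>\<sigma>. evals A f [encode \<sigma>] (y \<sigma>)" "\<And>\<sigma>. d \<sigma> = of_rat (nat_to_rat_surj (y \<sigma>))"
    by metis
  then have y': "computable A y" unfolding computable_def encode_nat_def by blast
  show "computable_fraction A d"
    by (rule computable_fractionI[OF computable_comp[OF computable_rat_numerator y']
          computable_comp[OF computable_rat_denominator y'] rat_denominator_pos])
      (use nonneg in \<open>simp add: y(2) max_absorb2 flip: max_0_rat\<close>)
next
  assume "computable_fraction A d"
  then obtain a c where ac: "computable A a" "computable A c" "\<And>\<sigma>. 0 < c \<sigma>" "\<And>\<sigma>. d \<sigma> = real (a \<sigma>) / real (c \<sigma>)"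
    by (rule computable_fractionE) blast
  have "computable A (\<lambda>\<sigma>. (a \<sigma> + a \<sigma>, c \<sigma> + c \<sigma>))" by (intro computable_intros ac)
  then obtain f where f: "\<And>\<sigma>. evals A f [str_code \<sigma>] (prod_encode (a \<sigma> + a \<sigma>, c \<sigma> + c \<sigma>))"
    unfolding computable_def encode_prod_def encode_str by auto
  have "d \<sigma> = of_rat (nat_to_rat_surj (prod_encode (a \<sigma> + a \<sigma>, c \<sigma> + c \<sigma>)))" for \<sigma>
    using ac(3)[of \<sigma>] unfolding ac(4) by (simp add: nat_to_rat_surj_def int_decode_eq_if of_rat_rat)
  with f show "exactly_computable A d" unfolding exactly_computable_def by blast
qed

lemma real_computable_if_exactly:
  assumes "exactly_computable A d" shows "real_computable A d"
proof -
  obtain f where f: "\<And>\<sigma>. \<exists>y. evals A f [str_code \<sigma>] y \<and> d \<sigma> = of_rat (nat_to_rat_surj y)"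
    using assms unfolding exactly_computable_def by blast
  have "\<exists>y. evals A (Cmp f [Proj 0]) [str_code \<sigma>, n] y \<and> \<bar>d \<sigma> - of_rat (nat_to_rat_surj y)\<bar> \<le> 1 / 2 ^ n" for \<sigma> n
  proof -
    obtain y where y: "evals A f [str_code \<sigma>] y" "d \<sigma> = of_rat (nat_to_rat_surj y)" using f by blast
    have "evals A (Cmp f [Proj 0]) [str_code \<sigma>, n] y"
      using y(1) evals.proj[of 0 "[str_code \<sigma>, n]" A] by (intro evals.cmp[where ys = "[str_code \<sigma>]"]) auto
    with y(2) show ?thesis by auto
  qed
  then show ?thesis unfolding real_computable_def by blast
qed

text \<open>
  Raising negative approximations to zero brings them closer to the nonnegative value that they
  approximate.
\<close>

lemma real_computable_approximation:
  assumes "real_computable A d" and nonneg: "\<And>\<sigma>. 0 \<le> d \<sigma>"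
  obtains r where "computable_fraction A (\<lambda>p. r (fst p) (snd p))"
    and "\<And>\<sigma> n. \<bar>d \<sigma> - r \<sigma> n\<bar> \<le> 1 / 2 ^ n"
proof -
  obtain f where "\<And>\<sigma> n. \<exists>y. evals A f [encode \<sigma>, n] y \<and> \<bar>d \<sigma> - of_rat (nat_to_rat_surj y)\<bar> \<le> 1 / 2 ^ n"
    using assms(1) unfolding real_computable_def encode_str by blast
  then obtain y where y: "\<And>\<sigma> n. evals A f [encode \<sigma>, n] (y \<sigma> n)"
      "\<And>\<sigma> n. \<bar>d \<sigma> - of_rat (nat_to_rat_surj (y \<sigma> n))\<bar> \<le> 1 / 2 ^ n"
    by metis
  have "computable A (fst :: str \<times> nat \<Rightarrow> str)" "computable A (snd :: str \<times> nat \<Rightarrow> nat)"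
    by (intro computable_intros)+
  then obtain e e' where e: "\<And>p :: str \<times> nat. evals A e [encode p] (encode (fst p))"
      "\<And>p :: str \<times> nat. evals A e' [encode p] (encode (snd p))"
    unfolding computable_def by blast
  have "evals A (Cmp f [e, e']) [encode p] (y (fst p) (snd p))" for p
    using e[of p] y(1)[of "fst p" "snd p"]
    by (intro evals.cmp[where ys = "[encode (fst p), snd p]"]) auto
  then have y': "computable A (\<lambda>p. y (fst p) (snd p))" unfolding computable_def encode_nat_def by blast
  show thesis
  proof (rule that[of "\<lambda>\<sigma> n. max 0 (of_rat (nat_to_rat_surj (y \<sigma> n)))"])
    show "computable_fraction A (\<lambda>p. max 0 (of_rat (nat_to_rat_surj (y (fst p) (snd p)))))"
      unfolding max_0_rat
      by (intro computable_fractionI[OF computable_comp[OF computable_rat_numerator y']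
            computable_comp[OF computable_rat_denominator y'] rat_denominator_pos] refl)
    show "\<bar>d \<sigma> - max 0 (of_rat (nat_to_rat_surj (y \<sigma> n)))\<bar> \<le> 1 / 2 ^ n" for \<sigma> n
      using y(2)[of \<sigma> n] nonneg[of \<sigma>] by linarith
  qed
qed

section \<open>Exactly computable martingales\<close>

definition exact_martingale :: "cantor \<Rightarrow> (str \<Rightarrow> real) \<Rightarrow> bool" where
  "exact_martingale A d \<longleftrightarrow> martingale d \<and> exactly_computable A d"

lemma martingale_nonneg: "martingale d \<Longrightarrow> 0 \<le> d \<sigma>"
  unfolding martingale_def by blast

lemma martingale_average: "martingale d \<Longrightarrow> d (\<sigma> @ [False]) + d (\<sigma> @ [True]) = 2 * d \<sigma>"
  unfolding martingale_def by (metis field_sum_of_halves mult_2 add_divide_distrib)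

lemma martingaleI:
  assumes "\<And>\<sigma>. 0 \<le> d \<sigma>" "\<And>\<sigma>. d (\<sigma> @ [False]) + d (\<sigma> @ [True]) = 2 * d \<sigma>"
  shows "martingale d"
  using assms unfolding martingale_def by simp

lemma exact_martingale_iff: "exact_martingale A d \<longleftrightarrow> martingale d \<and> computable_fraction A d"
  unfolding exact_martingale_def
  using exactly_computable_iff_fraction[of d A] martingale_nonneg[of d] by blast

text \<open>
  Let \<open>f \<sigma>\<close> be a rational within \<open>2 ^ - length \<sigma>\<close> of \<open>d \<sigma>\<close>. The function \<open>f\<close> is not fair, but
  betting half the difference of its values at the two successors is, and it imitates the increments
  of \<open>d\<close>. The errors are summable along every path, so a larger initial capital keeps the new
  martingale above \<open>d\<close>, and in particular nonnegative.
\<close>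

lemma real_computable_dominated:
  assumes d: "martingale d" "real_computable A d"
  obtains e where "exact_martingale A e" "\<And>\<sigma>. d \<sigma> \<le> e \<sigma>"
proof -
  obtain r where r: "computable_fraction A (\<lambda>p. r (fst p) (snd p))"
      and rd: "\<And>\<sigma> n. \<bar>d \<sigma> - r \<sigma> n\<bar> \<le> 1 / 2 ^ n"
    using real_computable_approximation[OF d(2) martingale_nonneg[OF d(1)]] by blast
  define f where "f \<sigma> = r \<sigma> (length \<sigma>)" for \<sigma>
  have fC: "computable_fraction A f"
    using computable_fraction_comp[OF r, of "\<lambda>\<sigma>. (\<sigma>, length \<sigma>)"]
    unfolding f_def by (simp add: computable_intros)
  define inc where "inc \<sigma> b = (f (\<sigma> @ [b]) - f (\<sigma> @ [\<not> b])) / 2" for \<sigma> b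
  define E where "E = foldl (\<lambda>(\<sigma>, v) b. (\<sigma> @ [b], v + inc \<sigma> b)) ([], f [] + 2)"
  define e where "e \<sigma> = snd (E \<sigma>)" for \<sigma>
  have "fst (E \<sigma>) = \<sigma>" for \<sigma> by (induction \<sigma> rule: rev_induct) (auto simp: E_def split: prod.splits)
  then have eS: "e (\<sigma> @ [b]) = e \<sigma> + inc \<sigma> b" for \<sigma> b
    unfolding e_def E_def by (simp add: case_prod_beta)
  have e0: "e [] = f [] + 2" by (simp add: e_def E_def)
  \<comment> \<open>A step to length \<open>n + 1\<close> loses at most \<open>2 ^ - (n + 1)\<close>, which is the decrease of the reserve
    from \<open>2 ^ - n\<close> to \<open>2 ^ - (n + 1)\<close>; the initial capital allows for the error at the empty string.\<close>
  have lower: "d \<sigma> + 1 / 2 ^ length \<sigma> \<le> e \<sigma>" for \<sigma>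
  proof (induction \<sigma> rule: rev_induct)
    case Nil show ?case using rd[of "[]" 0] by (simp add: e0 f_def)
  next
    case (snoc b \<sigma>)
    have avg: "d (\<sigma> @ [b]) + d (\<sigma> @ [\<not> b]) = 2 * d \<sigma>"
      using martingale_average[OF d(1), of \<sigma>] by (cases b) auto
    have "\<bar>d (\<sigma> @ [c]) - f (\<sigma> @ [c])\<bar> \<le> 1 / 2 ^ Suc (length \<sigma>)" for c
      using rd[of "\<sigma> @ [c]" "Suc (length \<sigma>)"] by (simp add: f_def)
    moreover have "x - w - \<delta> \<le> (u - v) / 2"
      if "\<bar>x - u\<bar> \<le> \<delta>" "\<bar>y - v\<bar> \<le> \<delta>" "x + y = 2 * w" for x y u v w \<delta> :: real
      using that by (simp add: field_simps abs_le_iff)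
    ultimately have "inc \<sigma> b \<ge> d (\<sigma> @ [b]) - d \<sigma> - 1 / 2 ^ Suc (length \<sigma>)"
      using avg unfolding inc_def by blast
    with snoc.IH show ?case by (simp add: eS)
  qed
  then have dom: "d \<sigma> \<le> e \<sigma>" for \<sigma>
    by (meson add_increasing2 dual_order.trans le_add_same_cancel1 zero_le_divide_1_iff zero_le_numeral zero_le_power)
  then have nonneg: "0 \<le> e \<sigma>" for \<sigma> using martingale_nonneg[OF d(1), of \<sigma>] by (meson order_trans)
  have "martingale e"
    by (rule martingaleI[OF nonneg]) (simp add: eS inc_def field_simps)
  moreover have "computable_fraction A e"
  proof (rule computable_fraction_snoc_rec[where g = e and m = "\<lambda>_ _. 1"
        and u = "\<lambda>\<sigma> b. f (\<sigma> @ [b]) * (1/2)" and v = "\<lambda>\<sigma> b. f (\<sigma> @ [\<not> b]) * (1/2)"])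
    have "f [] \<in> \<rat>" using fC by (auto elim!: computable_fractionE)
    then show "e [] \<in> \<rat>" by (simp add: e0)
    show "computable_fraction A (\<lambda>p :: str \<times> bool. f (fst p @ [snd p]) * (1/2))"
      "computable_fraction A (\<lambda>p :: str \<times> bool. f (fst p @ [\<not> snd p]) * (1/2))"
      by (rule computable_fraction_mult[OF computable_fraction_comp[OF fC] computable_fraction_const];
          simp add: computable_snoc computable_not computable_fst computable_snd computable_id)+
    show "computable_fraction A (\<lambda>p :: str \<times> bool. 1)" by (rule computable_fraction_const) auto
    show "e (\<sigma> @ [b]) = e \<sigma> * 1 + f (\<sigma> @ [b]) * (1/2) - f (\<sigma> @ [\<not> b]) * (1/2)" for \<sigma> b
      by (simp add: eS inc_def field_simps)
  qed (rule nonneg)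
  ultimately show thesis using that dom unfolding exact_martingale_iff by blast
qed

section \<open>Cylinders and the uniform measure\<close>

definition tail :: "nat \<Rightarrow> cantor \<Rightarrow> cantor" where
  "tail k X = (\<lambda>n. X (k + n))"

lemma length_seg [simp]: "length (seg X n) = n"
  by (simp add: seg_def)

lemma seg_0 [simp]: "seg X 0 = []"
  by (simp add: seg_def)

lemma seg_Suc: "seg X (Suc n) = seg X n @ [X n]"
  by (simp add: seg_def)

lemma seg_add: "seg X (m + n) = seg X m @ seg (tail m X) n"
  by (induction n) (simp_all add: seg_Suc tail_def)

lemma tail_0 [simp]: "tail 0 X = X"
  by (simp add: tail_def)

lemma tail_tail: "tail m (tail n X) = tail (n + m) X"
  by (simp add: tail_def add.assoc)

lemma seg_Cons: "seg X (Suc n) = X 0 # seg (tail 1 X) n"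
  using seg_add[of X 1 n] by (simp add: seg_Suc)

lemma seg_eq_append_iff:
  "seg X n = \<sigma> @ \<tau> \<longleftrightarrow> n = length \<sigma> + length \<tau> \<and> seg X (length \<sigma>) = \<sigma> \<and> seg (tail (length \<sigma>) X) (length \<tau>) = \<tau>"
proof
  assume *: "seg X n = \<sigma> @ \<tau>"
  then have n: "n = length \<sigma> + length \<tau>" using length_seg[of X n] by simp
  with * show "n = length \<sigma> + length \<tau> \<and> seg X (length \<sigma>) = \<sigma> \<and> seg (tail (length \<sigma>) X) (length \<tau>) = \<tau>"
    by (simp add: seg_add)
qed (metis seg_add)

lemma strict_prefix_seg_iff: "strict_prefix \<tau> (seg X n) \<longleftrightarrow> (\<exists>m<n. \<tau> = seg X m)"
proof
  assume "strict_prefix \<tau> (seg X n)"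
  then obtain \<rho> where "seg X n = \<tau> @ \<rho>" "\<rho> \<noteq> []" by (auto simp: strict_prefix_def prefix_def)
  then show "\<exists>m<n. \<tau> = seg X m" by (auto simp: seg_eq_append_iff intro!: exI[of _ "length \<tau>"])
next
  assume "\<exists>m<n. \<tau> = seg X m"
  then obtain m where "m < n" "\<tau> = seg X m" by blast
  then show "strict_prefix \<tau> (seg X n)"
    using seg_add[of X m "n - m"] length_seg by (auto simp: strict_prefix_def prefix_def) (metis length_seg less_not_refl)
qed

definition cylinder :: "str \<Rightarrow> cantor set \<Rightarrow> cantor set" where
  "cylinder \<sigma> B = {X. seg X (length \<sigma>) = \<sigma> \<and> tail (length \<sigma>) X \<in> B}"

lemma cylinder_Nil [simp]: "cylinder [] B = B"
  by (simp add: cylinder_def)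

lemma cylinder_Cons: "cylinder (b # \<sigma>) B = cylinder [b] (cylinder \<sigma> B)"
  by (auto simp: cylinder_def seg_Cons tail_tail)

lemma open_gen_eq_UN_cylinder: "open_gen S = (\<Union>\<sigma>\<in>S. cylinder \<sigma> UNIV)"
  by (auto simp: open_gen_def cylinder_def) (metis length_seg)

lemma sequence_space_bernoulli: "sequence_space (measure_pmf (bernoulli_pmf (1/2)))"
  by unfold_locales

lemma space_uniform [simp]: "space uniform_measure_cantor = UNIV"
  by (simp add: uniform_measure_cantor_def space_PiM)

interpretation uniform: prob_space uniform_measure_cantor
proof -
  interpret sequence_space "measure_pmf (bernoulli_pmf (1/2))" by (rule sequence_space_bernoulli)
  show "prob_space uniform_measure_cantor"
    unfolding uniform_measure_cantor_def by unfold_locales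
qed

text \<open>
  The uniform measure is the law of a fair bit followed by an independent uniform sequence.
\<close>

lemma
  assumes B: "B \<in> sets uniform_measure_cantor"
  shows sets_cylinder_bit: "cylinder [b] B \<in> sets uniform_measure_cantor"
    and emeasure_cylinder_bit:
      "emeasure uniform_measure_cantor (cylinder [b] B) = emeasure uniform_measure_cantor B / 2"
proof -
  let ?N = "measure_pmf (bernoulli_pmf (1/2))" and ?M = uniform_measure_cantor
  interpret sequence_space ?N by (rule sequence_space_bernoulli)
  have M: "?M = S" by (simp add: uniform_measure_cantor_def)
  have [measurable]: "(\<lambda>X. X n) \<in> measurable ?M (count_space UNIV)" for n
    unfolding M using measurable_component_singleton[of n UNIV "\<lambda>_. ?N"]
    by (simp add: measurable_cong_sets[OF refl sets_measure_pmf_count_space])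
  have [measurable]: "tail 1 \<in> measurable ?M ?M"
    unfolding M tail_def
  proof (rule measurable_PiM_single')
    show "(\<lambda>X. X (1 + i)) \<in> measurable S ?N" for i
      by (rule measurable_component_singleton) simp
  qed (simp add: space_PiM)
  note B [measurable]
  have eq: "cylinder [b] B = {X \<in> space ?M. X 0 = b \<and> tail 1 X \<in> B}"
    by (auto simp: cylinder_def seg_Suc)
  show sets: "cylinder [b] B \<in> sets ?M" unfolding eq by measurable
  let ?f = "\<lambda>(s, \<omega>). case_nat s \<omega> :: nat \<Rightarrow> bool"
  have f: "?f \<in> measurable (?N \<Otimes>\<^sub>M S) S"
    unfolding split_beta' by (rule measurable_case_nat') measurable
  have "emeasure ?M (cylinder [b] B) = emeasure (distr (?N \<Otimes>\<^sub>M S) S ?f) (cylinder [b] B)"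
    by (simp add: PiM_iter M)
  also have "\<dots> = emeasure (?N \<Otimes>\<^sub>M S) (?f -` cylinder [b] B \<inter> space (?N \<Otimes>\<^sub>M S))"
    using f sets by (subst emeasure_distr) (auto simp: M)
  also have "?f -` cylinder [b] B \<inter> space (?N \<Otimes>\<^sub>M S) = {b} \<times> B"
    by (auto simp: cylinder_def seg_Suc space_pair_measure space_PiM tail_def)
  also have "emeasure (?N \<Otimes>\<^sub>M S) ({b} \<times> B) = emeasure ?N {b} * emeasure S B"
    using B by (intro P.emeasure_pair_measure_Times) (auto simp: M)
  also have "emeasure ?N {b} = 1 / 2"
    by (cases b) (simp_all add: emeasure_pmf_single ennreal_divide_numeral flip: ennreal_1)
  finally show "emeasure ?M (cylinder [b] B) = emeasure ?M B / 2"
    by (simp add: M divide_ennreal_def mult.commute)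
qed

lemma
  assumes B: "B \<in> sets uniform_measure_cantor"
  shows sets_cylinder: "cylinder \<sigma> B \<in> sets uniform_measure_cantor"
    and emeasure_cylinder: "emeasure uniform_measure_cantor (cylinder \<sigma> B) =
      ennreal (1 / 2 ^ length \<sigma>) * emeasure uniform_measure_cantor B"
proof -
  have "cylinder \<sigma> B \<in> sets uniform_measure_cantor \<and> emeasure uniform_measure_cantor (cylinder \<sigma> B) =
      ennreal (1 / 2 ^ length \<sigma>) * emeasure uniform_measure_cantor B"
  proof (induction \<sigma>)
    case Nil show ?case using B by simp
  next
    case (Cons b \<sigma>)
    then have "emeasure uniform_measure_cantor (cylinder (b # \<sigma>) B) =
        ennreal (1 / 2 ^ length \<sigma>) * emeasure uniform_measure_cantor B / 2"
      unfolding cylinder_Cons[of b \<sigma>] by (simp add: emeasure_cylinder_bit)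
    also have "\<dots> = ennreal (1 / 2 ^ length (b # \<sigma>)) * emeasure uniform_measure_cantor B"
    proof -
      have "ennreal (1 / 2 ^ length (b # \<sigma>)) = ennreal (1 / 2 ^ length \<sigma>) / 2"
        using ennreal_divide_numeral[of "1 / 2 ^ length \<sigma>" "num.Bit0 num.One"] by (simp add: mult.commute)
      then show ?thesis by (simp add: ennreal_times_divide mult.commute)
    qed
    finally show ?case
      using Cons sets_cylinder_bit[of "cylinder \<sigma> B" b] by (simp add: cylinder_Cons[of b \<sigma>])
  qed
  then show "cylinder \<sigma> B \<in> sets uniform_measure_cantor"
    "emeasure uniform_measure_cantor (cylinder \<sigma> B) =
      ennreal (1 / 2 ^ length \<sigma>) * emeasure uniform_measure_cantor B" by auto
qed

lemma sets_open_gen: "open_gen S \<in> sets uniform_measure_cantor"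
  unfolding open_gen_eq_UN_cylinder
  by (intro sets.countable_UN'' sets_cylinder) (auto intro: countable_subset[OF subset_UNIV] simp flip: space_uniform)

lemma measure_open_gen_Nil: "[] \<in> S \<Longrightarrow> measure uniform_measure_cantor (open_gen S) = 1"
proof -
  assume "[] \<in> S"
  then have "open_gen S = UNIV" by (auto simp: open_gen_def intro: exI[of _ 0])
  then show ?thesis using uniform.prob_space by (simp only: space_uniform)
qed

text \<open>
  The cylinders over a prefix-free set are disjoint. For \<open>B = UNIV\<close> the left-hand side is the measure of
  \<open>open_gen S\<close>, so the sum of weights on the right is that measure.
\<close>

lemma emeasure_UN_cylinder:
  assumes pf: "prefix_free S" and B: "B \<in> sets uniform_measure_cantor"
  shows "emeasure uniform_measure_cantor (\<Union>\<sigma>\<in>S. cylinder \<sigma> B) =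
    (\<integral>\<^sup>+\<sigma>. ennreal (1 / 2 ^ length \<sigma>) \<partial>count_space S) * emeasure uniform_measure_cantor B"
proof -
  have "disjoint_family_on (\<lambda>\<sigma>. cylinder \<sigma> B) S"
  proof (unfold disjoint_family_on_def, intro ballI impI)
    fix \<sigma> \<tau> assume st: "\<sigma> \<in> S" "\<tau> \<in> S" "\<sigma> \<noteq> \<tau>"
    have False if X: "seg X (length \<sigma>) = \<sigma>" "seg X (length \<tau>) = \<tau>" for X
    proof (cases "length \<sigma>" "length \<tau>" rule: linorder_cases)
      case less
      then have "strict_prefix \<sigma> \<tau>" using X strict_prefix_seg_iff[of \<sigma> X "length \<tau>"] by metis
      then show False using pf st unfolding prefix_free_def by blast
    next
      case equal then show False using X st(3) by simp
    next
      case greater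
      then have "strict_prefix \<tau> \<sigma>" using X strict_prefix_seg_iff[of \<tau> X "length \<sigma>"] by metis
      then show False using pf st unfolding prefix_free_def by blast
    qed
    then show "cylinder \<sigma> B \<inter> cylinder \<tau> B = {}" unfolding cylinder_def by blast
  qed
  then have "emeasure uniform_measure_cantor (\<Union>\<sigma>\<in>S. cylinder \<sigma> B) =
      (\<integral>\<^sup>+\<sigma>. emeasure uniform_measure_cantor (cylinder \<sigma> B) \<partial>count_space S)"
    by (intro emeasure_UN_countable sets_cylinder B) (auto intro: countable_subset[OF subset_UNIV])
  also have "\<dots> = (\<integral>\<^sup>+\<sigma>. ennreal (1 / 2 ^ length \<sigma>) * emeasure uniform_measure_cantor B \<partial>count_space S)"
    by (simp add: emeasure_cylinder[OF B])
  finally show ?thesis by (simp add: nn_integral_multc)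
qed

section \<open>Concatenation powers of a prefix-free set\<close>

primrec concat_power :: "str set \<Rightarrow> nat \<Rightarrow> str set" where
  "concat_power S 0 = {[]}"
| "concat_power S (Suc n) = {\<sigma> @ \<tau> |\<sigma> \<tau>. \<sigma> \<in> S \<and> \<tau> \<in> concat_power S n}"

lemma concat_power_mono: "S \<subseteq> T \<Longrightarrow> concat_power S n \<subseteq> concat_power T n"
  by (induction n) auto

lemma concat_power_snoc:
  "\<rho> \<in> concat_power S n \<Longrightarrow> \<tau> \<in> S \<Longrightarrow> \<rho> @ \<tau> \<in> concat_power S (Suc n)"
proof (induction n arbitrary: \<rho>)
  case 0 then show ?case by force
next
  case (Suc n)
  then obtain \<sigma> \<rho>' where "\<rho> = \<sigma> @ \<rho>'" "\<sigma> \<in> S" "\<rho>' \<in> concat_power S n" by auto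
  with Suc show ?case by (auto simp del: concat_power.simps(2) simp: concat_power.simps(2)[of S "Suc n"])
qed

lemma prefix_free_concat_power:
  assumes S: "prefix_free S" shows "prefix_free (concat_power S n)"
proof (induction n)
  case 0 show ?case by (auto simp: prefix_free_def)
next
  case (Suc n)
  have "\<not> strict_prefix (\<sigma> @ \<tau>) (\<sigma>' @ \<tau>')"
    if "\<sigma> \<in> S" "\<sigma>' \<in> S" "\<tau> \<in> concat_power S n" "\<tau>' \<in> concat_power S n" for \<sigma> \<tau> \<sigma>' \<tau>'
  proof
    assume *: "strict_prefix (\<sigma> @ \<tau>) (\<sigma>' @ \<tau>')"
    then have "prefix \<sigma> \<sigma>' \<or> prefix \<sigma>' \<sigma>"
      by (metis prefix_def prefix_same_cases append_prefixD strict_prefixE)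
    then have "\<sigma> = \<sigma>'" using S that(1,2) unfolding prefix_free_def strict_prefix_def by blast
    with * have "strict_prefix \<tau> \<tau>'" by (auto simp: strict_prefix_def)
    then show False using Suc that(3,4) unfolding prefix_free_def by blast
  qed
  then show ?case unfolding prefix_free_def by auto
qed

lemma open_gen_concat_power_Suc:
  "open_gen (concat_power S (Suc n)) = (\<Union>\<sigma>\<in>S. cylinder \<sigma> (open_gen (concat_power S n)))"
  unfolding open_gen_def cylinder_def
  by (auto simp: seg_eq_append_iff) (metis seg_eq_append_iff length_seg)+

lemma emeasure_concat_power:
  assumes "prefix_free S"
  shows "emeasure uniform_measure_cantor (open_gen (concat_power S n)) =
    emeasure uniform_measure_cantor (open_gen S) ^ n"
proof (induction n)
  case 0
  have "open_gen {[]} = space uniform_measure_cantor" by (auto simp: open_gen_def intro: exI[of _ 0])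
  then show ?case by (simp add: uniform.emeasure_space_1 del: space_uniform)
next
  case (Suc n)
  have "emeasure uniform_measure_cantor (open_gen S) = (\<integral>\<^sup>+\<sigma>. ennreal (1 / 2 ^ length \<sigma>) \<partial>count_space S)"
    using emeasure_UN_cylinder[OF assms, of UNIV] uniform.emeasure_space_1 sets.top[of uniform_measure_cantor]
    by (simp add: open_gen_eq_UN_cylinder)
  then show ?case
    unfolding open_gen_concat_power_Suc emeasure_UN_cylinder[OF assms sets_open_gen] Suc by simp
qed

lemma open_gen_concat_power_antimono:
  "m \<le> n \<Longrightarrow> open_gen (concat_power S n) \<subseteq> open_gen (concat_power S m)"
proof (induction m arbitrary: n)
  case 0 show ?case by (auto simp: open_gen_def intro: exI[of _ 0])
next
  case (Suc m)
  then obtain n' where "n = Suc n'" "m \<le> n'" by (cases n) auto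
  with Suc.IH[of n'] show ?case unfolding \<open>n = Suc n'\<close> open_gen_concat_power_Suc
    by (auto simp: cylinder_def)
qed

subsection \<open>Greedy parsing into blocks\<close>

text \<open>
  A string is read bit by bit, and a block is cut off as soon as the bits since the last cut satisfy
  \<open>P\<close>; \<open>pending\<close> is the part after the last cut and \<open>completed\<close> the list of blocks cut off. The same
  parser decides membership in concatenation powers and tells a martingale when to restart.
\<close>

definition pending :: "(str \<Rightarrow> bool) \<Rightarrow> str \<Rightarrow> str" where
  "pending P \<sigma> = foldl (\<lambda>\<tau> b. if P (\<tau> @ [b]) then [] else \<tau> @ [b]) [] \<sigma>"

lemma pending_Nil [simp]: "pending P [] = []"
  by (simp add: pending_def)

lemma pending_snoc [simp]:
  "pending P (\<sigma> @ [b]) = (if P (pending P \<sigma> @ [b]) then [] else pending P \<sigma> @ [b])"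
  by (simp add: pending_def)

definition completed :: "(str \<Rightarrow> bool) \<Rightarrow> str \<Rightarrow> str list" where
  "completed P \<sigma> = concat (map (\<lambda>i. if P (pending P (take i \<sigma>) @ [\<sigma> ! i])
    then [pending P (take i \<sigma>) @ [\<sigma> ! i]] else []) [0..<length \<sigma>])"

lemma completed_Nil [simp]: "completed P [] = []"
  by (simp add: completed_def)

lemma completed_snoc [simp]:
  "completed P (\<sigma> @ [b]) =
    completed P \<sigma> @ (if P (pending P \<sigma> @ [b]) then [pending P \<sigma> @ [b]] else [])"
proof -
  let ?f = "\<lambda>\<sigma> i. if P (pending P (take i \<sigma>) @ [\<sigma> ! i]) then [pending P (take i \<sigma>) @ [\<sigma> ! i]] else []"
  have "take i (\<sigma> @ [b]) = take i \<sigma>" "(\<sigma> @ [b]) ! i = \<sigma> ! i" if "i \<in> set [0..<length \<sigma>]" for i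
    using that by (simp_all add: nth_append)
  then have "map (?f (\<sigma> @ [b])) [0..<length \<sigma>] = map (?f \<sigma>) [0..<length \<sigma>]"
    by (intro map_cong refl) (simp only:)
  then show ?thesis
    by (simp only: completed_def length_append_singleton upt_Suc_append[OF le0] map_append concat_append) simp
qed

text \<open>
  After a cut the parser has forgotten the past, so reading a minimal string with \<open>P\<close> adds exactly that
  string as a block.
\<close>

lemma parse_block:
  assumes "pending P \<rho> = []" "\<And>\<tau>'. strict_prefix \<tau>' \<tau> \<Longrightarrow> \<not> P \<tau>'" "\<tau> \<noteq> []"
  shows "pending P (\<rho> @ \<tau>) = (if P \<tau> then [] else \<tau>)"
    and "completed P (\<rho> @ \<tau>) = completed P \<rho> @ (if P \<tau> then [\<tau>] else [])"
proof -
  have "pending P (\<rho> @ \<tau>) = (if P \<tau> then [] else \<tau>) \<and>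
      completed P (\<rho> @ \<tau>) = completed P \<rho> @ (if P \<tau> then [\<tau>] else [])"
    using assms(2,3)
  proof (induction \<tau> rule: rev_induct)
    case (snoc b \<tau>)
    have "\<not> P \<tau>" by (rule snoc.prems(1)) (simp add: strict_prefix_def)
    moreover have "\<not> P \<tau>'" if "strict_prefix \<tau>' \<tau>" for \<tau>'
      by (rule snoc.prems(1)) (use that in \<open>auto simp: strict_prefix_def\<close>)
    ultimately have "pending P (\<rho> @ \<tau>) = \<tau> \<and> completed P (\<rho> @ \<tau>) = completed P \<rho>"
      using snoc.IH assms(1) by (cases "\<tau> = []") auto
    then show ?case by (simp flip: append_assoc)
  qed simp
  then show "pending P (\<rho> @ \<tau>) = (if P \<tau> then [] else \<tau>)"
    "completed P (\<rho> @ \<tau>) = completed P \<rho> @ (if P \<tau> then [\<tau>] else [])" by auto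
qed

lemma parse_decomposition:
  "\<exists>\<rho>. \<sigma> = \<rho> @ pending P \<sigma> \<and> \<rho> \<in> concat_power {\<tau>. P \<tau>} (length (completed P \<sigma>))"
proof (induction \<sigma> rule: rev_induct)
  case (snoc b \<sigma>)
  then obtain \<rho> where \<rho>: "\<sigma> = \<rho> @ pending P \<sigma>" "\<rho> \<in> concat_power {\<tau>. P \<tau>} (length (completed P \<sigma>))" by blast
  show ?case
  proof (cases "P (pending P \<sigma> @ [b])")
    case True
    have "\<rho> @ (pending P \<sigma> @ [b]) \<in> concat_power {\<tau>. P \<tau>} (Suc (length (completed P \<sigma>)))"
      using True by (intro concat_power_snoc \<rho>(2)) simp
    moreover have "\<rho> @ (pending P \<sigma> @ [b]) = \<sigma> @ [b]" using \<rho>(1) by (metis append_assoc)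
    ultimately show ?thesis using True by (intro exI[of _ "\<sigma> @ [b]"]) (simp del: concat_power.simps)
  next
    case False
    have "\<sigma> @ [b] = \<rho> @ (pending P \<sigma> @ [b])" using \<rho>(1) by (metis append_assoc)
    with False \<rho>(2) show ?thesis by (intro exI[of _ \<rho>]) simp
  qed
qed simp

text \<open>
  In a prefix-free set the factors of a product are determined by the product, so the greedy
  factorisation is the only one.
\<close>

lemma concat_power_iff_parse:
  assumes "prefix_free {\<tau>. P \<tau>}" "\<not> P []"
  shows "\<sigma> \<in> concat_power {\<tau>. P \<tau>} n \<longleftrightarrow> pending P \<sigma> = [] \<and> length (completed P \<sigma>) = n"
proof
  have "pending P (\<rho> @ \<sigma>) = [] \<and> length (completed P (\<rho> @ \<sigma>)) = length (completed P \<rho>) + n"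
    if "\<sigma> \<in> concat_power {\<tau>. P \<tau>} n" "pending P \<rho> = []" for \<rho> \<sigma> n
    using that
  proof (induction n arbitrary: \<rho> \<sigma>)
    case (Suc n)
    then obtain \<tau> \<sigma>' where *: "\<sigma> = \<tau> @ \<sigma>'" "P \<tau>" "\<sigma>' \<in> concat_power {\<tau>. P \<tau>} n" by auto
    have np: "\<not> P \<tau>'" if "strict_prefix \<tau>' \<tau>" for \<tau>'
      using assms(1) *(2) that unfolding prefix_free_def by blast
    have "\<tau> \<noteq> []" using *(2) assms(2) by auto
    from parse_block[OF Suc.prems(2) np this] *(2)
    have "pending P (\<rho> @ \<tau>) = []" "length (completed P (\<rho> @ \<tau>)) = Suc (length (completed P \<rho>))" by auto
    with Suc.IH[OF *(3), of "\<rho> @ \<tau>"] show ?case by (simp add: *(1))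
  qed simp
  from this[of \<sigma> n "[]"]
  show "\<sigma> \<in> concat_power {\<tau>. P \<tau>} n \<Longrightarrow> pending P \<sigma> = [] \<and> length (completed P \<sigma>) = n" by simp
qed (use parse_decomposition[of \<sigma> P] in auto)

lemma computable_pending:
  assumes "computable A (\<lambda>p. P (fst p) (snd p))"
  shows "computable A (\<lambda>p. pending (P (fst p)) (snd p))"
proof (rule computable_snoc_rec[where h = "\<lambda>x. pending (P x)"
      and s = "\<lambda>x \<sigma> b \<tau>. if P x (\<tau> @ [b]) then [] else \<tau> @ [b]"])
  have "computable A (\<lambda>p :: 'a \<times> str \<times> bool \<times> str. P (fst p) (snd (snd (snd p)) @ [fst (snd (snd p))]))"
    using computable_comp[OF assms, of "\<lambda>p. (fst p, snd (snd (snd p)) @ [fst (snd (snd p))])"]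
    by (simp add: computable_Pair computable_fst computable_snd computable_snoc computable_id)
  then show "computable A (\<lambda>p :: 'a \<times> str \<times> bool \<times> str. if P (fst p) (snd (snd (snd p)) @ [fst (snd (snd p))])
      then [] else snd (snd (snd p)) @ [fst (snd (snd p))])"
    by (intro computable_intros)
qed (simp_all add: computable_const)

lemma computable_next_block:
  assumes "computable A (\<lambda>p. P (fst p) (snd p))"
  shows "computable A (\<lambda>q. P (fst q) (pending (P (fst q)) (fst (snd q)) @ [snd (snd q)]))"
proof -
  have "computable A (\<lambda>q :: 'a \<times> str \<times> bool. pending (P (fst q)) (fst (snd q)))"
    using computable_comp[OF computable_pending[OF assms], of "\<lambda>q. (fst q, fst (snd q))"]
    by (simp add: computable_Pair computable_fst computable_snd computable_id)
  then have "computable A (\<lambda>q :: 'a \<times> str \<times> bool. (fst q, pending (P (fst q)) (fst (snd q)) @ [snd (snd q)]))"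
    by (intro computable_intros)
  from computable_comp[OF assms this] show ?thesis by simp
qed

lemma computable_length_completed:
  assumes "computable A (\<lambda>p. P (fst p) (snd p))"
  shows "computable A (\<lambda>p. length (completed (P (fst p)) (snd p)))"
proof (rule computable_snoc_rec[where h = "\<lambda>x \<sigma>. length (completed (P x) \<sigma>)"
      and s = "\<lambda>x \<sigma> b r. r + (if P x (pending (P x) \<sigma> @ [b]) then 1 else 0)"])
  have "computable A (\<lambda>p :: 'a \<times> str \<times> bool \<times> nat.
      P (fst p) (pending (P (fst p)) (fst (snd p)) @ [fst (snd (snd p))]))"
    using computable_comp[OF computable_next_block[OF assms],
        of "\<lambda>p. (fst p, fst (snd p), fst (snd (snd p)))"]
    by (simp add: computable_Pair computable_fst computable_snd computable_id)
  then show "computable A (\<lambda>p :: 'a \<times> str \<times> bool \<times> nat. snd (snd (snd p)) +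
      (if P (fst p) (pending (P (fst p)) (fst (snd p)) @ [fst (snd (snd p))]) then 1 else 0))"
    by (intro computable_intros)
qed (simp_all add: computable_const)

text \<open>
  The part of \<open>S\<close> that is enumerated by a given stage is decidable and, like \<open>S\<close>, prefix-free, so
  greedy parsing decides membership in its powers. The powers of \<open>S\<close> are the increasing unions of
  these, as a product has finitely many factors.
\<close>

lemma semidecidable_concat_power:
  assumes ce: "ce S" and pf: "prefix_free S" and "[] \<notin> S"
  shows "semidecidable (\<lambda>(n, \<sigma>). \<sigma> \<in> concat_power S n)"
proof -
  from ce have "semidecidable (\<lambda>\<sigma>. \<sigma> \<in> S)" by (simp only: ce_iff_semidecidable)
  then obtain Q :: "nat \<Rightarrow> str \<Rightarrow> bool" where
    Q: "computable (\<lambda>_. False) (\<lambda>p. Q (fst p) (snd p))" and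
    S: "\<And>\<sigma>. \<sigma> \<in> S \<longleftrightarrow> (\<exists>t. Q t \<sigma>)" and mono: "\<And>s t \<sigma>. Q s \<sigma> \<Longrightarrow> s \<le> t \<Longrightarrow> Q t \<sigma>"
    by (rule semidecidable_stages) blast
  have pfQ: "prefix_free {\<tau>. Q t \<tau>}" and "\<not> Q t []" for t
    using pf \<open>[] \<notin> S\<close> S unfolding prefix_free_def by blast+
  note iff = concat_power_iff_parse[OF this]
  have union: "\<sigma> \<in> concat_power S n \<longleftrightarrow> (\<exists>t. \<sigma> \<in> concat_power {\<tau>. Q t \<tau>} n)" for \<sigma> n
  proof
    show "\<sigma> \<in> concat_power S n \<Longrightarrow> \<exists>t. \<sigma> \<in> concat_power {\<tau>. Q t \<tau>} n"
    proof (induction n arbitrary: \<sigma>)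
      case (Suc n)
      then obtain \<tau> \<sigma>' where *: "\<sigma> = \<tau> @ \<sigma>'" "\<tau> \<in> S" "\<sigma>' \<in> concat_power S n" by auto
      obtain s where s: "Q s \<tau>" using *(2) S by blast
      obtain t where t: "\<sigma>' \<in> concat_power {\<tau>. Q t \<tau>} n" using Suc.IH[OF *(3)] by blast
      have "{\<tau>. Q t \<tau>} \<subseteq> {\<tau>. Q (max s t) \<tau>}" using mono by auto
      from concat_power_mono[OF this] t have "\<sigma>' \<in> concat_power {\<tau>. Q (max s t) \<tau>} n" by blast
      moreover have "Q (max s t) \<tau>" using mono[OF s] by simp
      ultimately show ?case using *(1) by auto
    qed simp
    show "\<exists>t. \<sigma> \<in> concat_power {\<tau>. Q t \<tau>} n \<Longrightarrow> \<sigma> \<in> concat_power S n"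
      using concat_power_mono[of "{\<tau>. Q _ \<tau>}" S n] S by blast
  qed
  have "computable (\<lambda>_. False) (\<lambda>p :: nat \<times> nat \<times> str. (fst p, snd (snd p)))"
    by (intro computable_intros)
  from computable_comp[OF computable_pending[OF Q] this] computable_comp[OF computable_length_completed[OF Q] this]
  have "computable (\<lambda>_. False) (\<lambda>p :: nat \<times> nat \<times> str. pending (Q (fst p)) (snd (snd p)))"
    "computable (\<lambda>_. False) (\<lambda>p :: nat \<times> nat \<times> str. length (completed (Q (fst p)) (snd (snd p))))" by simp_all
  then have "computable (\<lambda>_. False) (\<lambda>p :: nat \<times> nat \<times> str. length (pending (Q (fst p)) (snd (snd p))) = 0
      \<and> length (completed (Q (fst p)) (snd (snd p))) = fst (snd p))"
    by (intro computable_intros)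
  from semidecidable_ex[OF this] show ?thesis
    by (simp add: union iff split_beta')
qed

section \<open>Sequences that are not Martin-Loef random\<close>

text \<open>
  The powers of a prefix-free set of measure below one have measures tending to zero geometrically;
  every \<open>c\<close>-th of them gives a test.
\<close>

lemma not_MLR_if_all_concat_powers:
  assumes S: "ce S" "prefix_free S" "measure uniform_measure_cantor (open_gen S) < 1"
    and X: "\<And>n. X \<in> open_gen (concat_power S n)"
  shows "X \<notin> MLR"
proof -
  let ?m = "measure uniform_measure_cantor (open_gen S)"
  have "[] \<notin> S" using S(3) measure_open_gen_Nil by fastforce
  have "\<exists>c. ?m ^ c < 1 / 2" using S(3) by (intro real_arch_pow_inv) auto
  then obtain c where c: "?m ^ c < 1 / 2" by blast
  have mn: "measure uniform_measure_cantor (open_gen (concat_power S n)) = ?m ^ n" for n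
    using emeasure_concat_power[OF S(2), of n]
    by (simp add: uniform.emeasure_eq_measure ennreal_power)
  let ?V = "\<lambda>n. open_gen (concat_power S (c * n))"
  have "decseq ?V"
    unfolding decseq_def using open_gen_concat_power_antimono by (simp add: mult_le_mono2)
  moreover have "uniformly_ce_open ?V"
    unfolding uniformly_ce_open_def
  proof (intro exI[of _ "\<lambda>n. concat_power S (c * n)"] conjI allI refl)
    have "computable (\<lambda>_. False) (\<lambda>p :: nat \<times> str. (c * fst p, snd p))" by (intro computable_intros)
    from semidecidable_comp[OF semidecidable_concat_power[OF S(1,2) \<open>[] \<notin> S\<close>] this]
    show "uniformly_ce (\<lambda>n. concat_power S (c * n))"
      by (simp add: uniformly_ce_iff_semidecidable split_beta')
  qed (rule prefix_free_concat_power[OF S(2)])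
  moreover have "measure uniform_measure_cantor (?V n) \<le> 1 / 2 ^ n" for n
    using power_mono[of "?m ^ c" "1 / 2" n] c by (simp add: mn power_mult power_divide)
  ultimately have "MartinLof_test ?V" unfolding MartinLof_test_def by blast
  moreover have "\<not> passes X ?V" unfolding passes_def using X by blast
  ultimately show ?thesis unfolding MLR_def by blast
qed

text \<open>
  Deleting a first bit \<open>b\<close> turns a test into a test: the sequences that enter level \<open>n + 1\<close> after a \<open>b\<close>
  has been put in front form a set of at most twice the measure of that level. The empty string
  generates the whole space and therefore occurs at no level from \<open>1\<close> on.
\<close>

lemma not_MLR_tail_1:
  assumes "X \<notin> MLR" shows "tail 1 X \<notin> MLR"
proof -
  obtain V where V: "MartinLof_test V" "\<not> passes X V" using assms unfolding MLR_def by blast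
  then obtain G where G: "uniformly_ce G" "\<And>n. prefix_free (G n)" "\<And>n. V n = open_gen (G n)"
    unfolding MartinLof_test_def uniformly_ce_open_def by blast
  have m: "measure uniform_measure_cantor (V n) \<le> 1 / 2 ^ n" and dec: "decseq V" for n
    using V(1) unfolding MartinLof_test_def by auto
  define H where "H n = {\<tau>. X 0 # \<tau> \<in> G (Suc n)}" for n
  define W where "W n = open_gen (H n)" for n
  have "[] \<notin> G (Suc n)" for n
  proof
    assume "[] \<in> G (Suc n)"
    from measure_open_gen_Nil[OF this] m[of "Suc n"] have "(1::real) \<le> 1 / 2 ^ Suc n" by (simp only: G(3))
    moreover have "(2::real) ^ Suc n > 1" by (rule one_less_power) auto
    ultimately show False by simp
  qed
  then have W_iff: "tail 1 Z \<in> W n \<longleftrightarrow> Z \<in> V (Suc n)" if "Z 0 = X 0" for Z n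
  proof -
    have "(\<exists>k. seg Z k \<in> G (Suc n)) \<longleftrightarrow> (\<exists>k. seg Z (Suc k) \<in> G (Suc n))"
      using \<open>[] \<notin> G (Suc n)\<close> by (metis seg_0 not0_implies_Suc)
    then show ?thesis by (simp add: W_def H_def open_gen_def G(3) seg_Cons that)
  qed
  have cyl: "cylinder [X 0] (W n) \<subseteq> V (Suc n)" for n
    using W_iff by (auto simp: cylinder_def seg_Suc)
  have "decseq W"
  proof (rule decseq_SucI, rule subsetI)
    fix n Z assume Z: "Z \<in> W (Suc n)"
    have "tail 1 (case_nat (X 0) Z) = Z" by (simp add: tail_def)
    then show "Z \<in> W n"
      using W_iff[of "case_nat (X 0) Z"] Z decseq_SucD[OF dec, of "Suc n"] by auto
  qed
  moreover have "uniformly_ce_open W"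
    unfolding uniformly_ce_open_def W_def
  proof (intro exI[of _ H] conjI allI refl)
    have "computable (\<lambda>_. False) (\<lambda>p :: nat \<times> str. (Suc (fst p), [X 0] @ snd p))" by (intro computable_intros)
    from semidecidable_comp[OF G(1)[unfolded uniformly_ce_iff_semidecidable] this]
    show "uniformly_ce H" by (simp add: uniformly_ce_iff_semidecidable H_def split_beta')
    have "strict_prefix (X 0 # \<sigma>) (X 0 # \<tau>) \<longleftrightarrow> strict_prefix \<sigma> \<tau>" for \<sigma> \<tau>
      by (simp add: strict_prefix_def)
    then show "prefix_free (H n)" for n
      using G(2)[of "Suc n"] unfolding prefix_free_def H_def by blast
  qed
  moreover have "measure uniform_measure_cantor (W n) \<le> 1 / 2 ^ n" for n
  proof -
    have "W n \<in> sets uniform_measure_cantor" "V (Suc n) \<in> sets uniform_measure_cantor"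
      unfolding W_def G(3) by (rule sets_open_gen)+
    then have "emeasure uniform_measure_cantor (W n) / 2 \<le> emeasure uniform_measure_cantor (V (Suc n))"
      using emeasure_mono[OF cyl] by (metis emeasure_cylinder_bit)
    then have "measure uniform_measure_cantor (W n) / 2 \<le> measure uniform_measure_cantor (V (Suc n))"
      by (simp add: uniform.emeasure_eq_measure ennreal_divide_numeral)
    with m[of "Suc n"] show ?thesis by simp
  qed
  ultimately have "MartinLof_test W" unfolding MartinLof_test_def by blast
  moreover have "\<not> passes (tail 1 X) W"
    using V(2) W_iff[of X] unfolding passes_def by auto
  ultimately show ?thesis unfolding MLR_def by blast
qed

lemma not_MLR_tail: "X \<notin> MLR \<Longrightarrow> tail k X \<notin> MLR"
proof (induction k)
  case (Suc k) then show ?case using not_MLR_tail_1[of "tail k X"] by (simp add: tail_tail)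
qed simp

section \<open>Success of martingales\<close>

text \<open>
  The first \<open>N\<close> values have a maximum, so an unbounded sequence of values is unbounded beyond \<open>N\<close>.
\<close>

lemma succeedsI:
  assumes "\<And>c. \<exists>n. c < d (seg X n)" shows "succeeds d X"
  unfolding succeeds_def
proof (rule ccontr)
  assume "limsup (\<lambda>n. ereal (d (seg X n))) \<noteq> \<infinity>"
  then obtain c where "limsup (\<lambda>n. ereal (d (seg X n))) < ereal c"
    by (metis less_PInf_Ex_of_nat ereal_infty_less(1))
  then have "eventually (\<lambda>n. ereal (d (seg X n)) < ereal c) sequentially" by (rule Limsup_lessD)
  then obtain N where N: "\<And>n. N \<le> n \<Longrightarrow> d (seg X n) < c" unfolding eventually_sequentially by auto
  let ?m = "Max ((\<lambda>n. d (seg X n)) ` {..N})"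
  obtain n where n: "max c ?m < d (seg X n)" using assms by blast
  show False
  proof (cases "N \<le> n")
    case True then show False using N[of n] n by simp
  next
    case False
    then have "d (seg X n) \<le> ?m" by (intro Max_ge) auto
    moreover have "?m < d (seg X n)" using n by (rule max.strict_boundedE)
    ultimately show False by linarith
  qed
qed

lemma not_succeedsI:
  assumes "\<And>n. m \<le> n \<Longrightarrow> d (seg X n) \<le> c" shows "\<not> succeeds d X"
proof -
  have "limsup (\<lambda>n. ereal (d (seg X n))) \<le> ereal c"
    by (rule Limsup_bounded) (use assms in \<open>auto simp: eventually_sequentially\<close>)
  then show ?thesis unfolding succeeds_def by auto
qed

lemma succeeds_mono:
  assumes "succeeds d X" "\<And>\<sigma>. d \<sigma> \<le> e \<sigma>" shows "succeeds e X"
proof -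
  have "limsup (\<lambda>n. ereal (d (seg X n))) \<le> limsup (\<lambda>n. ereal (e (seg X n)))"
    by (rule Limsup_mono) (simp add: assms(2))
  with assms(1) show ?thesis unfolding succeeds_def by simp
qed

lemma open_gen_minimal_iff:
  "X \<in> open_gen {\<sigma>. minimal_for P \<sigma>} \<longleftrightarrow> (\<exists>n. P (seg X n))"
proof
  assume "\<exists>n. P (seg X n)"
  then have "P (seg X (LEAST n. P (seg X n)))" by (rule LeastI_ex)
  moreover have "\<not> P \<tau>" if "strict_prefix \<tau> (seg X (LEAST n. P (seg X n)))" for \<tau>
    using that not_less_Least by (auto simp: strict_prefix_seg_iff)
  ultimately show "X \<in> open_gen {\<sigma>. minimal_for P \<sigma>}" unfolding open_gen_def minimal_for_def by blast
qed (auto simp: open_gen_def minimal_for_def)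

section \<open>Restarting a martingale\<close>

text \<open>
  Play \<open>d\<close>, and whenever it has reached \<open>q\<close> start it anew on the rest of the sequence with the capital won
  so far. On a sequence all of whose tails let \<open>d\<close> reach \<open>q\<close> there are infinitely many restarts, and
  the capital exceeds every power of \<open>q\<close>. The capital at the last restart is the product of the values of
  \<open>d\<close> on the completed blocks of the greedy parse for \<open>q \<le> d \<tau>\<close>.
\<close>

lemma restarted_martingale:
  assumes d: "exact_martingale A d" "normed d" and q: "1 < (of_rat q :: real)"
  obtains e where "exact_martingale A e"
    and "\<And>X. (\<And>k. \<exists>n. of_rat q \<le> d (seg (tail k X) n)) \<Longrightarrow> succeeds e X"
proof -
  let ?r = "of_rat q :: real"
  define P where "P \<tau> \<longleftrightarrow> ?r \<le> d \<tau>" for \<tau>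
  have mg: "martingale d" and frac: "computable_fraction A d" and d1: "d [] = 1"
    using d by (auto simp: exact_martingale_iff normed_def)
  have P0: "\<not> P []" using q by (simp add: P_def d1)
  define capital where "capital \<sigma> = prod_list (map d (completed P \<sigma>))" for \<sigma>
  define e where "e \<sigma> = capital \<sigma> * d (pending P \<sigma>)" for \<sigma>
  have capital0: "capital [] = 1" by (simp add: capital_def)
  have capitalS: "capital (\<sigma> @ [b]) =
      capital \<sigma> * (if P (pending P \<sigma> @ [b]) then d (pending P \<sigma> @ [b]) else 1)" for \<sigma> b
    by (simp add: capital_def)
  \<comment> \<open>This holds with and without a cut after \<open>b\<close>: a cut moves the factor into the capital and
    leaves the factor \<open>d [] = 1\<close>.\<close>
  have eS: "e (\<sigma> @ [b]) = capital \<sigma> * d (pending P \<sigma> @ [b])" for \<sigma> b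
    by (simp add: e_def capitalS d1)
  have capital_nonneg: "0 \<le> capital \<sigma>" for \<sigma>
    by (induction \<sigma> rule: rev_induct) (auto simp: capital0 capitalS martingale_nonneg[OF mg])
  have "martingale e"
  proof (rule martingaleI)
    show "0 \<le> e \<sigma>" for \<sigma> by (simp add: e_def capital_nonneg martingale_nonneg[OF mg])
    show "e (\<sigma> @ [False]) + e (\<sigma> @ [True]) = 2 * e \<sigma>" for \<sigma>
      unfolding eS unfolding e_def distrib_left[symmetric] martingale_average[OF mg] by simp
  qed
  moreover have "computable_fraction A e"
  proof -
    have PC: "computable A P" unfolding P_def
      using q by (intro computable_fraction_le computable_fraction_const frac) auto
    have PC': "computable A (\<lambda>p :: nat \<times> str. P (snd p))"
      by (rule computable_comp[OF PC]) (intro computable_intros)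
    have "computable A (\<lambda>\<sigma> :: str. (0 :: nat, \<sigma>))" by (intro computable_intros)
    from computable_comp[OF computable_pending[where P = "\<lambda>_ :: nat. P", OF PC'] this]
    have pend: "computable A (pending P)" by simp
    have "computable A (\<lambda>p :: str \<times> bool. pending P (fst p))"
      by (rule computable_comp[OF pend]) (intro computable_intros)
    then have ext: "computable A (\<lambda>p :: str \<times> bool. pending P (fst p) @ [snd p])"
      by (intro computable_intros)
    have "computable_fraction A capital"
    proof (rule computable_fraction_snoc_rec[where g = capital and u = "\<lambda>_ _. 0" and v = "\<lambda>_ _. 0"
          and m = "\<lambda>\<sigma> b. if P (pending P \<sigma> @ [b]) then d (pending P \<sigma> @ [b]) else 1"])
      show "computable_fraction A (\<lambda>p :: str \<times> bool.
          if P (pending P (fst p) @ [snd p]) then d (pending P (fst p) @ [snd p]) else 1)"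
        by (intro computable_fraction_If computable_comp[OF PC ext] computable_fraction_comp[OF frac ext]
            computable_fraction_const) auto
    qed (auto simp: capital0 capitalS capital_nonneg intro: computable_fraction_const)
    then show ?thesis
      unfolding e_def by (intro computable_fraction_mult computable_fraction_comp[OF frac pend])
  qed
  moreover have "succeeds e X" if X: "\<And>k. \<exists>n. ?r \<le> d (seg (tail k X) n)" for X
  proof -
    have "\<exists>n. pending P (seg X n) = [] \<and> ?r ^ k \<le> capital (seg X n)" for k
    proof (induction k)
      case 0 show ?case by (intro exI[of _ 0]) (simp add: capital0)
    next
      case (Suc k)
      then obtain n where n: "pending P (seg X n) = []" "?r ^ k \<le> capital (seg X n)" by blast
      obtain m where m: "minimal_for P (seg (tail n X) m)"
        using X[of n] open_gen_minimal_iff[of "tail n X" P] unfolding P_def[symmetric] open_gen_def by auto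
      let ?\<tau> = "seg (tail n X) m"
      have "P ?\<tau>" and min: "\<And>\<tau>. strict_prefix \<tau> ?\<tau> \<Longrightarrow> \<not> P \<tau>" using m unfolding minimal_for_def by auto
      then have "?\<tau> \<noteq> []" using P0 by metis
      from parse_block[OF n(1) min this] \<open>P ?\<tau>\<close>
      have "pending P (seg X (n + m)) = []" "capital (seg X (n + m)) = capital (seg X n) * d ?\<tau>"
        by (auto simp: seg_add capital_def)
      moreover have "?r ^ k * ?r \<le> capital (seg X n) * d ?\<tau>"
        using n(2) \<open>P ?\<tau>\<close> q capital_nonneg unfolding P_def by (intro mult_mono) auto
      ultimately show ?case by (intro exI[of _ "n + m"]) (simp add: mult.commute)
    qed
    then have grow: "\<exists>n. ?r ^ k \<le> e (seg X n)" for k unfolding e_def by (metis d1 mult_1_right)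
    show ?thesis
    proof (rule succeedsI)
      fix c
      obtain k where "c < ?r ^ k" using real_arch_pow[OF q] by blast
      with grow[of k] show "\<exists>n. c < e (seg X n)" by (meson less_le_trans)
    qed
  qed
  ultimately show thesis using that unfolding exact_martingale_iff by blast
qed

section \<open>A sequence on which no computable martingale succeeds\<close>

instance code :: countable
  by countable_datatype

text \<open>
  Distinct martingales have distinct codes, since a code has only one value on each argument.
\<close>

lemma countable_exact_martingales: "countable {d. exact_martingale A d}"
proof -
  define f where "f d = (SOME c. \<forall>\<sigma>. \<exists>y. evals A c [str_code \<sigma>] y \<and> d \<sigma> = real_of_rat (nat_to_rat_surj y))" for d
  have f: "\<exists>y. evals A (f d) [str_code \<sigma>] y \<and> d \<sigma> = real_of_rat (nat_to_rat_surj y)"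
    if "exact_martingale A d" for d \<sigma>
    using someI_ex[of "\<lambda>c. \<forall>\<sigma>. \<exists>y. evals A c [str_code \<sigma>] y \<and> d \<sigma> = real_of_rat (nat_to_rat_surj y)"] that
    unfolding exact_martingale_def exactly_computable_def f_def by blast
  have "inj_on f {d. exact_martingale A d}"
  proof (rule inj_onI, rule ext)
    fix d e \<sigma> assume de: "d \<in> {d. exact_martingale A d}" "e \<in> {d. exact_martingale A d}" "f d = f e"
    show "d \<sigma> = e \<sigma>" using f[of d \<sigma>] f[of e \<sigma>] de by (auto dest: evals_deterministic)
  qed
  then show ?thesis by (rule countable_image_inj_on[rotated]) simp
qed

lemma exact_martingale_one: "exact_martingale A (\<lambda>_. 1)"
  by (simp add: exact_martingale_iff martingale_def computable_fraction_const)

lemma exact_martingale_add_fraction: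
  assumes "exact_martingale A d" "exact_martingale A e"
  shows "exact_martingale A (\<lambda>\<sigma>. d \<sigma> + e \<sigma> / real N)"
proof -
  have mg: "martingale d" "martingale e" and frac: "computable_fraction A d" "computable_fraction A e"
    using assms by (auto simp: exact_martingale_iff)
  have "computable_fraction A (\<lambda>\<sigma>. d \<sigma> + e \<sigma> * (1 / real N))"
    by (intro computable_fraction_add computable_fraction_mult computable_fraction_const frac) auto
  moreover have "martingale (\<lambda>\<sigma>. d \<sigma> + e \<sigma> / real N)"
  proof (rule martingaleI)
    show "0 \<le> d \<sigma> + e \<sigma> / real N" for \<sigma> using martingale_nonneg mg by simp
    show "d (\<sigma> @ [False]) + e (\<sigma> @ [False]) / real N + (d (\<sigma> @ [True]) + e (\<sigma> @ [True]) / real N) =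
        2 * (d \<sigma> + e \<sigma> / real N)" for \<sigma>
      using martingale_average[OF mg(1), of \<sigma>] martingale_average[OF mg(2), of \<sigma>]
      by (simp add: algebra_simps flip: add_divide_distrib)
  qed
  ultimately show ?thesis by (simp add: exact_martingale_iff)
qed

text \<open>
  Above \<open>\<sigma>\<close> the martingale, divided by \<open>d \<sigma>\<close>, is a normed martingale, and the sequences on which it
  ever reaches a rational \<open>q > 1\<close> form a winning open set. This set misses a sequence of \<open>open_gen S\<close>, along
  which \<open>d\<close> therefore stays below \<open>q * d \<sigma>\<close>; \<open>\<tau>\<close> is the prefix of it that lies in \<open>S\<close>.
\<close>

lemma uncovered_extension:
  assumes d: "exact_martingale A d" "0 < d \<sigma>" and \<delta>: "0 < \<delta>"
    and uncovered: "\<And>W. winning_open A W \<Longrightarrow> \<not> open_gen S \<subseteq> W"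
  obtains \<tau> where "\<tau> \<in> S" "\<And>\<rho>. prefix \<rho> \<tau> \<Longrightarrow> d (\<sigma> @ \<rho>) \<le> d \<sigma> + \<delta>"
proof -
  have mg: "martingale d" and frac: "computable_fraction A d"
    using d by (auto simp: exact_martingale_iff)
  define e where "e \<tau> = d (\<sigma> @ \<tau>) * (1 / d \<sigma>)" for \<tau>
  have "martingale e"
  proof (rule martingaleI)
    show "0 \<le> e \<tau>" for \<tau> using martingale_nonneg[OF mg] d(2) by (simp add: e_def)
    show "e (\<tau> @ [False]) + e (\<tau> @ [True]) = 2 * e \<tau>" for \<tau>
      using martingale_average[OF mg, of "\<sigma> @ \<tau>"] by (simp add: e_def flip: add_divide_distrib)
  qed
  moreover have "computable_fraction A e"
  proof -
    have "d \<sigma> \<in> \<rat>" using frac by (auto elim!: computable_fractionE)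
    moreover have "computable A (\<lambda>\<tau>. \<sigma> @ \<tau>)" by (intro computable_intros)
    ultimately show ?thesis unfolding e_def using d(2)
      by (intro computable_fraction_mult computable_fraction_comp[OF frac] computable_fraction_const) auto
  qed
  ultimately have e: "martingale e" "exactly_computable A e"
    using exact_martingale_iff exact_martingale_def by blast+
  have "normed e" using d(2) by (simp add: normed_def e_def)
  obtain q :: rat where q: "1 < real_of_rat q" "real_of_rat q < 1 + \<delta> / d \<sigma>"
    using of_rat_dense[of 1 "1 + \<delta> / d \<sigma>"] d(2) \<delta> by auto
  have "winning_open A (open_gen {\<tau>. minimal_for (\<lambda>\<tau>. of_rat q \<le> e \<tau>) \<tau>})"
    unfolding winning_open_def using e \<open>normed e\<close> q(1) by (metis one_less_of_rat_iff)
  from uncovered[OF this] obtain Y where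
    "Y \<in> open_gen S" "Y \<notin> open_gen {\<tau>. minimal_for (\<lambda>\<tau>. of_rat q \<le> e \<tau>) \<tau>}" by blast
  then obtain n where Y: "seg Y n \<in> S" "\<And>m. e (seg Y m) < of_rat q"
    unfolding open_gen_minimal_iff by (auto simp: open_gen_def not_le)
  show thesis
  proof (rule that[OF Y(1)])
    fix \<rho> assume "prefix \<rho> (seg Y n)"
    then obtain m where "\<rho> = seg Y m"
      using strict_prefix_seg_iff[of \<rho> Y n] by (cases "\<rho> = seg Y n") (auto simp: strict_prefix_def)
    then have "e \<rho> < 1 + \<delta> / d \<sigma>" using Y(2)[of m] q(2) by simp
    then have "d (\<sigma> @ \<rho>) < (1 + \<delta> / d \<sigma>) * d \<sigma>"
      using d(2) by (simp add: e_def pos_divide_less_eq)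
    then show "d (\<sigma> @ \<rho>) \<le> d \<sigma> + \<delta>" using d(2) by (simp add: distrib_right)
  qed
qed

lemma limit_of_extensions:
  assumes ext: "\<And>k. \<exists>\<tau>. s (Suc k) = s k @ \<tau> \<and> \<tau> \<noteq> []"
  obtains X where "\<And>k. seg X (length (s k)) = s k"
proof -
  have len: "k \<le> length (s k)" for k
  proof (induction k)
    case (Suc k)
    obtain \<tau> where "s (Suc k) = s k @ \<tau>" "\<tau> \<noteq> []" using ext by blast
    with Suc show ?case by (cases \<tau>) auto
  qed simp
  have pre: "j \<le> k \<Longrightarrow> prefix (s j) (s k)" for j k
  proof (induction k rule: dec_induct)
    case (step k)
    obtain \<tau> where "s (Suc k) = s k @ \<tau>" using ext by blast
    with step show ?case by (simp add: prefix_append)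
  qed simp
  \<comment> \<open>The string \<open>s (Suc n)\<close> has more than \<open>n\<close> bits.\<close>
  define X where "X n = s (Suc n) ! n" for n
  have "X n = s k ! n" if "n < length (s k)" for n k
  proof -
    have "n < length (s (Suc n))" using len[of "Suc n"] by simp
    with that pre[of k "Suc n"] pre[of "Suc n" k] show ?thesis
      unfolding X_def by (cases "k \<le> Suc n") (auto simp: prefix_def nth_append)
  qed
  then have "seg X (length (s k)) = s k" for k by (intro nth_equalityI) (auto simp: seg_def)
  with that show thesis by blast
qed

text \<open>
  The sequence is built from blocks in \<open>S\<close>, so that it lies in all concatenation powers of \<open>S\<close> and is
  not random. Let \<open>E\<close> enumerate the exactly computable martingales. The construction carries a martingale
  \<open>D\<close> that starts as the constant \<open>1\<close>, whence it is positive everywhere; at step \<open>k\<close> a small multiple of \<open>E k\<close>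
  is added to it, and then the string is extended by a block along which the new \<open>D\<close> hardly grows.
  Each of the two actions raises the capital by at most \<open>2 ^ - (k + 2)\<close>, so \<open>D\<close> never exceeds \<open>2\<close> along the
  sequence, and this bounds every \<open>E k\<close>. Martingales with real values are dominated by exactly computable
  ones.
\<close>

lemma uncovered_not_High:
  assumes S: "ce S" "prefix_free S" "measure uniform_measure_cantor (open_gen S) < 1"
    and uncovered: "\<And>W. winning_open A W \<Longrightarrow> \<not> open_gen S \<subseteq> W"
  obtains X where "X \<in> CR A" "X \<notin> MLR"
proof -
  have "[] \<notin> S" using S(3) measure_open_gen_Nil by fastforce
  define E where "E = from_nat_into {d. exact_martingale A d}"
  have E: "exact_martingale A (E k)" for k
    using from_nat_into[of "{d. exact_martingale A d}" k] exact_martingale_one unfolding E_def by blast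
  have E_surj: "\<exists>k. E k = d" if "exact_martingale A d" for d
    using from_nat_into_surj[OF countable_exact_martingales] that unfolding E_def by blast
  let ?P = "\<lambda>k (\<sigma>, D). exact_martingale A D \<and> (\<forall>\<tau>. 1 \<le> D \<tau>) \<and> D \<sigma> \<le> 2 - 1 / 2 ^ k \<and> \<sigma> \<in> concat_power S k"
  let ?Q = "\<lambda>k (\<sigma>, D) (\<sigma>', D'). \<exists>\<tau>. \<sigma>' = \<sigma> @ \<tau> \<and> \<tau> \<noteq> [] \<and> (\<exists>N. \<forall>\<rho>. E k \<rho> \<le> real N * D' \<rho>) \<and>
      (\<forall>\<rho>. D \<rho> \<le> D' \<rho>) \<and> (\<forall>\<rho>. prefix \<rho> \<tau> \<longrightarrow> D' (\<sigma> @ \<rho>) \<le> 2)"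
  have "\<exists>g. \<forall>k. ?P k (g k) \<and> ?Q k (g k) (g (Suc k))"
  proof (rule dependent_nat_choice)
    show "\<exists>x. ?P 0 x" by (intro exI[of _ "([], \<lambda>_. 1)"]) (simp add: exact_martingale_one)
  next
    fix x :: "str \<times> (str \<Rightarrow> real)" and k assume "?P k x"
    then obtain \<sigma> D where x: "x = (\<sigma>, D)" and D: "exact_martingale A D" "\<And>\<tau>. 1 \<le> D \<tau>"
        "D \<sigma> \<le> 2 - 1 / 2 ^ k" "\<sigma> \<in> concat_power S k" by auto
    define \<delta> :: real where "\<delta> = 1 / 2 ^ (k + 2)"
    have \<delta>: "0 < \<delta>" "2 - 1 / 2 ^ k + \<delta> + \<delta> = 2 - 1 / 2 ^ Suc k" by (simp_all add: \<delta>_def power_add)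
    \<comment> \<open>The weight \<open>1 / N\<close> of the new summand depends on its present value, which may be large.\<close>
    obtain N where N: "E k \<sigma> / \<delta> < real N" using reals_Archimedean2 by blast
    have E0: "0 \<le> E k \<rho>" for \<rho> using E[of k] martingale_nonneg unfolding exact_martingale_def by blast
    have "0 < real N" using N E0[of \<sigma>] \<delta>(1) by (meson divide_nonneg_pos le_less_trans)
    define D' where "D' \<rho> = D \<rho> + E k \<rho> / real N" for \<rho>
    have D': "exact_martingale A D'" unfolding D'_def by (rule exact_martingale_add_fraction[OF D(1) E])
    have le: "D \<rho> \<le> D' \<rho>" for \<rho> by (simp add: D'_def E0)
    have "E k \<sigma> / real N \<le> \<delta>" using N \<delta>(1) \<open>0 < real N\<close> by (simp add: field_simps)
    then have "D' \<sigma> \<le> 2 - 1 / 2 ^ k + \<delta>" using D(3) unfolding D'_def by linarith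
    moreover have "0 < D' \<sigma>" using le[of \<sigma>] D(2)[of \<sigma>] by linarith
    then obtain \<tau> where \<tau>: "\<tau> \<in> S" "\<And>\<rho>. prefix \<rho> \<tau> \<Longrightarrow> D' (\<sigma> @ \<rho>) \<le> D' \<sigma> + \<delta>"
      using uncovered_extension[OF D' _ \<delta>(1) uncovered] by blast
    ultimately have bound: "D' (\<sigma> @ \<rho>) \<le> 2 - 1 / 2 ^ Suc k" if "prefix \<rho> \<tau>" for \<rho>
      using \<tau>(2)[OF that] \<delta>(2) by linarith
    moreover have "(0::real) \<le> 1 / 2 ^ Suc k" by simp
    ultimately have bound2: "D' (\<sigma> @ \<rho>) \<le> 2" if "prefix \<rho> \<tau>" for \<rho>
      using that by (smt (verit))
    have dom: "E k \<rho> \<le> real N * D' \<rho>" for \<rho>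
      using \<open>0 < real N\<close> D(2)[of \<rho>] by (simp add: D'_def field_simps)
    have "1 \<le> D' \<tau>" for \<tau> using le[of \<tau>] D(2)[of \<tau>] by linarith
    then have "?P (Suc k) (\<sigma> @ \<tau>, D')"
      using D' bound[of \<tau>] concat_power_snoc[OF D(4) \<tau>(1)] by (simp del: concat_power.simps power_Suc)
    moreover have "?Q k x (\<sigma> @ \<tau>, D')"
      using \<tau>(1) \<open>[] \<notin> S\<close> le dom bound2 unfolding x by auto
    ultimately show "\<exists>y. ?P (Suc k) y \<and> ?Q k x y" by blast
  qed
  then obtain g where "\<forall>k. ?P k (g k) \<and> ?Q k (g k) (g (Suc k))" by (rule exE)
  note g = conjunct1[OF spec[OF this]] conjunct2[OF spec[OF this]]
  define s where "s k = fst (g k)" for k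
  define D where "D k = snd (g k)" for k
  have gk: "g k = (s k, D k)" for k by (simp add: s_def D_def)
  have D1: "1 \<le> D k \<tau>" and pow: "s k \<in> concat_power S k" for k \<tau>
    using g(1)[of k] unfolding gk by auto
  have step: "\<exists>\<tau>. s (Suc k) = s k @ \<tau> \<and> \<tau> \<noteq> [] \<and> (\<forall>\<rho>. prefix \<rho> \<tau> \<longrightarrow> D (Suc k) (s k @ \<rho>) \<le> 2)"
    and dom: "\<exists>N. \<forall>\<rho>. E k \<rho> \<le> real N * D (Suc k) \<rho>"
    and mono: "D k \<rho> \<le> D (Suc k) \<rho>" for k \<rho>
    using g(2)[of k] unfolding gk by auto
  obtain X where X: "\<And>k. seg X (length (s k)) = s k"
    using limit_of_extensions[of s] step by blast
  have bounded: "\<exists>c. \<forall>n\<ge>length (s j). E j (seg X n) \<le> c" for j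
  proof -
    obtain N where N: "\<And>\<rho>. E j \<rho> \<le> real N * D (Suc j) \<rho>" using dom by blast
    \<comment> \<open>The summand \<open>E j\<close> stays in all later martingales, so the bounds on these apply to it.\<close>
    have D_le: "D (Suc j) \<rho> \<le> D (Suc k) \<rho>" if "j \<le> k" for k \<rho>
      using that by (induction rule: dec_induct) (auto intro: order_trans mono)
    have "\<exists>k\<ge>j. D (Suc k) (seg X n) \<le> 2" if n: "length (s j) \<le> n" for n
    proof -
      have "\<forall>n. length (s j) \<le> n \<and> n \<le> length (s k) \<longrightarrow> (\<exists>k\<ge>j. D (Suc k) (seg X n) \<le> 2)" if "j \<le> k" for k
        using that
      proof (induction k rule: dec_induct)
        case base
        obtain \<tau> where "\<forall>\<rho>. prefix \<rho> \<tau> \<longrightarrow> D (Suc j) (s j @ \<rho>) \<le> 2" using step by blast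
        then have "D (Suc j) (s j @ []) \<le> 2" using Nil_prefix by blast
        then show ?case using X[of j] by (auto intro: exI[of _ j])
      next
        case (step k)
        obtain \<tau> where \<tau>: "s (Suc k) = s k @ \<tau>" "\<And>\<rho>. prefix \<rho> \<tau> \<Longrightarrow> D (Suc k) (s k @ \<rho>) \<le> 2"
          using \<open>\<And>k. \<exists>\<tau>. s (Suc k) = s k @ \<tau> \<and> \<tau> \<noteq> [] \<and> (\<forall>\<rho>. prefix \<rho> \<tau> \<longrightarrow> D (Suc k) (s k @ \<rho>) \<le> 2)\<close>
          by blast
        show ?case
        proof (intro allI impI)
          fix n assume n: "length (s j) \<le> n \<and> n \<le> length (s (Suc k))"
          show "\<exists>k\<ge>j. D (Suc k) (seg X n) \<le> 2"
          proof (cases "n \<le> length (s k)")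
            case True then show ?thesis using step.IH n by blast
          next
            case False
            then obtain m where m: "n = length (s k) + m" by (metis nat_le_iff_add nle_le)
            have "s (Suc k) = seg X (n + (length (s (Suc k)) - n))" using X[of "Suc k"] n by simp
            then have "prefix (seg (tail (length (s k)) X) m) \<tau>"
              unfolding m seg_add X \<tau>(1) by (auto simp: prefix_def)
            from \<tau>(2)[OF this] show ?thesis using step.hyps by (auto simp: m seg_add X intro: exI[of _ k])
          qed
        qed
      qed
      moreover have "k \<le> length (s k)" for k
      proof (induction k)
        case (Suc k) then show ?case using step[of k] by (metis length_append length_greater_0_conv
            less_eq_Suc_le less_le_trans add_strict_left_mono add.right_neutral le_less_trans not_less)
      qed simp
      then have "n \<le> length (s (max j n))" by (meson max.cobounded2 order_trans)
      ultimately show ?thesis using n by (meson max.cobounded1)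
    qed
    then have "E j (seg X n) \<le> real N * 2" if "length (s j) \<le> n" for n
      using that N[of "seg X n"] D_le[of _ "seg X n"]
      by (meson mult_left_mono of_nat_0_le_iff order_trans)
    then show ?thesis by blast
  qed
  have "X \<in> CR A"
    unfolding CR_def
  proof (intro CollectI allI impI)
    fix d assume "martingale d \<and> real_computable A d"
    then obtain e where e: "exact_martingale A e" "\<And>\<sigma>. d \<sigma> \<le> e \<sigma>"
      using real_computable_dominated by blast
    obtain j where "E j = e" using E_surj[OF e(1)] by blast
    with bounded[of j] have "\<not> succeeds e X" using not_succeedsI by blast
    then show "\<not> succeeds d X" using succeeds_mono e(2) by blast
  qed
  moreover have "X \<notin> MLR"
  proof (rule not_MLR_if_all_concat_powers[OF S])
    show "X \<in> open_gen (concat_power S n)" for n unfolding open_gen_def using X pow by (metis mem_Collect_eq)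
  qed
  ultimately show thesis using that by blast
qed

section \<open>The characterisation\<close>

theorem proposition4p3:
  fixes A :: cantor and U :: "nat \<Rightarrow> cantor set"
  assumes "universal_test U"
  shows "(A \<in> High CR MLR \<longleftrightarrow> (\<forall>V. bounded_ce_open V \<longrightarrow> (\<exists>W. winning_open A W \<and> V \<subseteq> W)))
    \<and> (A \<in> High CR MLR \<longleftrightarrow> (\<exists>W. winning_open A W \<and> U 1 \<subseteq> W))
    \<and> (A \<in> High CR MLR \<longleftrightarrow>
        (\<exists>d. martingale d \<and> real_computable A d \<and> (\<forall>X. X \<notin> MLR \<longrightarrow> succeeds d X)))"
proof -
  let ?i = "A \<in> High CR MLR"
  let ?ii = "\<forall>V. bounded_ce_open V \<longrightarrow> (\<exists>W. winning_open A W \<and> V \<subseteq> W)"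
  let ?iii = "\<exists>W. winning_open A W \<and> U 1 \<subseteq> W"
  let ?iv = "\<exists>d. martingale d \<and> real_computable A d \<and> (\<forall>X. X \<notin> MLR \<longrightarrow> succeeds d X)"
  have "?ii" if ?i
  proof (intro allI impI, rule ccontr)
    fix V assume "bounded_ce_open V" and no: "\<nexists>W. winning_open A W \<and> V \<subseteq> W"
    then obtain S where S: "ce S" "prefix_free S" "V = open_gen S" "measure uniform_measure_cantor V < 1"
      unfolding bounded_ce_open_def ce_open_def by blast
    from no have "\<not> open_gen S \<subseteq> W" if "winning_open A W" for W using that S(3) by blast
    with S obtain X where "X \<in> CR A" "X \<notin> MLR" using uncovered_not_High by blast
    with \<open>?i\<close> show False unfolding High_def by blast
  qed
  moreover have "?iii" if ?ii
  proof -
    have test: "MartinLof_test U" using assms unfolding universal_test_def by blast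
    then obtain G where G: "uniformly_ce G" "\<And>n. prefix_free (G n)" "\<And>n. U n = open_gen (G n)"
      unfolding MartinLof_test_def uniformly_ce_open_def by blast
    have "computable (\<lambda>_. False) (\<lambda>\<sigma> :: str. (1 :: nat, \<sigma>))" by (intro computable_intros)
    from semidecidable_comp[OF G(1)[unfolded uniformly_ce_iff_semidecidable] this]
    have "ce (G 1)" by (simp add: ce_iff_semidecidable)
    moreover have "measure uniform_measure_cantor (U 1) \<le> 1 / 2 ^ 1"
      using test unfolding MartinLof_test_def by blast
    ultimately have "bounded_ce_open (U 1)"
      unfolding bounded_ce_open_def ce_open_def using G(2,3) by force
    with \<open>?ii\<close> show ?thesis by blast
  qed
  moreover have "?iv" if ?iii
  proof -
    from that obtain d q where d: "martingale d" "normed d" "exactly_computable A d" and q: "(1 :: rat) < q"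
      and cover: "U 1 \<subseteq> open_gen {\<sigma>. minimal_for (\<lambda>\<tau>. d \<tau> \<ge> of_rat q) \<sigma>}"
      unfolding winning_open_def by blast
    obtain e where e: "exact_martingale A e"
      and win: "\<And>X. (\<And>k. \<exists>n. of_rat q \<le> d (seg (tail k X) n)) \<Longrightarrow> succeeds e X"
      using restarted_martingale[of A d q] d q unfolding exact_martingale_def by auto
    have "succeeds e X" if "X \<notin> MLR" for X
    proof (rule win)
      fix k
      have "\<not> passes (tail k X) U"
        using assms not_MLR_tail[OF that] unfolding universal_test_def by blast
      then have "tail k X \<in> U 1" unfolding passes_def by blast
      with cover show "\<exists>n. of_rat q \<le> d (seg (tail k X) n)" by (auto simp: open_gen_minimal_iff)
    qed
    with e real_computable_if_exactly show ?thesis unfolding exact_martingale_def by blast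
  qed
  moreover have "?i" if ?iv
    using that unfolding High_def CR_def by blast
  ultimately show ?thesis by blast
qed

end
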